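(* Let $\theta>0$ and let $k\ge1$ be an integer. For real $y_1<y_2$ with $y_2-y_1\le k^k$, write $P_k^\theta(y_1,y_2)=f(y_1-y_2)$ with $f(x)=\sum_{m=0}^\infty c_mx^m$. The coefficient of the $m$-th term of this power series representation is given by $$c_m=\sum_{H\in\mathscr{B}_k^m}\psi(H)\,\mathbb{E}[L^H]=\sum_{G\in\mathscr{A}_k^m}\psi(G)\sum_{H\cong^lG}\mathbb{E}[L^H].$$
   Context: Gap probability: let $\alpha$ be irrational with finite irrationality measure (the irrationality measure is the infimum of all $\lambda$ such that $|\alpha-p/q|<q^{-\lambda}$ has only finitely many integer solutions $p,q$). $P_k^\theta(y_1,y_2)$ is the limit as $n\to\infty$ of the probability that $\rho_{n,k}(\sigma)$ has no eigenangle in $(\alpha+y_1/n^k,\alpha+y_2/n^k)$, where $\sigma\in\mathfrak{S}_n$ has the Ewens law $\nu_{n,\theta}(\sigma)=\theta^{K(\sigma)}/(\theta(\theta+1)\cdots(\theta+n-1))$ ($K(\sigma)$ the number of cycles), $\rho_{n,k}$ is the permutation representation of $\mathfrak{S}_n$ on ordered $k$-tuples of distinct elements of $[n]$, and eigenangles are the $\phi$ with $e^{2\pi i\phi}$ an eigenvalue (extended with period 1). This limit equals (a result of the same paper) $$P_k^\theta(y_1,y_2)=\mathbb{E}\Big[\prod_{i_1<\dots<i_k}\Big(1-\min\Big(\tfrac{(y_2-y_1)\prod_{u=1}^kL_{i_u}}{g_k(\mathbf{X}_\infty^{i_1,\dots,i_k})},1\Big)\Big)\Big].$$ Here $(L_1,L_2,\dots)$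 is $PD(\theta)$-distributed: the decreasing order statistics of $V_j=W_j\prod_{i<j}(1-W_i)$ with $W_i$ i.i.d. of density $\theta(1-x)^{\theta-1}$ on $[0,1]$. Independently of it, $(X_{mi})_{m,i\ge1}$ are independent with $\mathbb{P}\{X_{mi}=a\}=(1-1/p_m)p_m^{-a}$, $a\ge0$ ($p_m$ the $m$-th prime); $\mathbf{X}_\infty^{i_1,\dots,i_k}$ is the $\infty\times k$ matrix with $(m,j)$ entry $X_{m,i_j}$; and $g_k(\mathbf{e})=\prod_{m\ge1}p_m^{e_{m1}+\dots+e_{mk}-\max(e_{m1},\dots,e_{mk})}$. Hypergraphs: a hypergraph is a pair $(V,E)$ with $E$ a multiset of non-empty subsets of $V$; a $j$-edge is an edge of size $j$. A labelled hypergraph has its vertices assigned distinct labels in $\{1,2,3,\dots\}$ (vertices are identified with their labels). $\mathscr{B}_k^m$ is the set of labelled hypergraphs whose edge set consists of $m$ distinct $k$-edges and which have no isolated vertices (every vertex lies in some edge). $\mathscr{A}_k^m\subset\mathscr{B}_k^m$ is the finite subset of those whose vertex label set is $\{1,\dots,r\}$ for some $r$. $H\cong^lG$ means there is a hypergraph isomorphism between $H$ and $G$ that preserves the order of the labels; the inner sum in the claim is over all $H\in\mathscr{B}_k^m$ with $H\cong^lG$. For $G\in\mathscr{B}_k^m$, $\psi(G)=\mathbb{E}\big[\prod_{(i_1,\dots,i_k)\in E(G)}1/g_k(\mathbf{X}_\infty^{i_1,\dots,i_k})\big]$. For $H\in\mathscr{B}_k^m$ with vertex labels $i_1<\dots<i_v$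 and $d_j$ the number of $k$-edges of $H$ containing $i_j$, $L^H:=L_{i_1}^{d_1}L_{i_2}^{d_2}\cdots L_{i_v}^{d_v}$. *)

theory Defs
  imports "HOL-Probability.Probability" "HOL-Combinatorics.Orbits"
    "HOL-Library.Infinite_Set" "HOL-Library.Multiset"
    "HOL-Computational_Algebra.Primes"
begin

section \<open>Irrationality measure\<close>

definition irrationality_measure :: "real \<Rightarrow> ereal" where
  "irrationality_measure \<alpha> =
     Inf (ereal ` {l :: real. finite {(p :: int, q :: int).
            q > 0 \<and> \<bar>\<alpha> - of_int p / of_int q\<bar> < of_int q powr (- l)}})"

section \<open>Eigenangles of the permutation representation and the gap probability\<close>

definition ewens :: "real \<Rightarrow> nat \<Rightarrow> (nat \<Rightarrow> nat) \<Rightarrow> real" where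
  "ewens \<theta> n \<sigma> = \<theta> ^ card (orbit \<sigma> ` {1..n}) / pochhammer \<theta> n"

definition distinct_tuples :: "nat \<Rightarrow> nat \<Rightarrow> nat list set" where
  "distinct_tuples n k = {t. length t = k \<and> distinct t \<and> set t \<subseteq> {1..n}}"

text \<open>The representation space is the space of complex functions that vanish outside
  \<^term>\<open>distinct_tuples n k\<close>. The function \<^term>\<open>perm_rep \<sigma> v\<close> is the linear extension of
  the map that sends the basis vector of a tuple \<^term>\<open>t\<close> to that of \<^term>\<open>map \<sigma> t\<close>.\<close>

definition rep_space :: "nat \<Rightarrow> nat \<Rightarrow> (nat list \<Rightarrow> complex) set" where
  "rep_space n k = {v. \<forall>t. t \<notin> distinct_tuples n k \<longrightarrow> v t = 0}"

definition perm_rep :: "(nat \<Rightarrow> nat) \<Rightarrow> (nat list \<Rightarrow> complex) \<Rightarrow> nat list \<Rightarrow> complex" where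
  "perm_rep \<sigma> v = (\<lambda>t. v (map (inv \<sigma>) t))"

definition rep_eigenvalue :: "nat \<Rightarrow> nat \<Rightarrow> (nat \<Rightarrow> nat) \<Rightarrow> complex \<Rightarrow> bool" where
  "rep_eigenvalue n k \<sigma> z \<longleftrightarrow>
     (\<exists>v \<in> rep_space n k. v \<noteq> (\<lambda>t. 0) \<and> perm_rep \<sigma> v = (\<lambda>t. z * v t))"

definition eigenangle :: "nat \<Rightarrow> nat \<Rightarrow> (nat \<Rightarrow> nat) \<Rightarrow> real \<Rightarrow> bool" where
  "eigenangle n k \<sigma> \<phi> \<longleftrightarrow> rep_eigenvalue n k \<sigma> (cis (2 * pi * \<phi>))"

definition finite_gap_probability ::
  "real \<Rightarrow> nat \<Rightarrow> real \<Rightarrow> real \<Rightarrow> real \<Rightarrow> nat \<Rightarrow> real" where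
  "finite_gap_probability \<theta> k \<alpha> y1 y2 n =
     (\<Sum>\<sigma> \<in> {\<sigma>. \<sigma> permutes {1..n} \<and>
          (\<forall>\<phi> \<in> {\<alpha> + y1 / real n ^ k <..< \<alpha> + y2 / real n ^ k}. \<not> eigenangle n k \<sigma> \<phi>)}.
        ewens \<theta> n \<sigma>)"

definition gap_probability :: "real \<Rightarrow> nat \<Rightarrow> real \<Rightarrow> real \<Rightarrow> real \<Rightarrow> real" where
  "gap_probability \<theta> k \<alpha> y1 y2 = lim (finite_gap_probability \<theta> k \<alpha> y1 y2)"

section \<open>The Poisson-Dirichlet distribution\<close>

definition stick_law :: "real \<Rightarrow> real measure" where
  "stick_law \<theta> =
     density lborel (\<lambda>x. ennreal (indicator {0..1} x * (\<theta> * (1 - x) powr (\<theta> - 1))))"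

definition stick_breaking :: "(nat \<Rightarrow> real) \<Rightarrow> nat \<Rightarrow> real" where
  "stick_breaking w j = w j * (\<Prod>i<j. 1 - w i)"

text \<open>The \<open>i\<close>-th largest term (\<open>i \<ge> 1\<close>, counted with multiplicity) of a sequence.\<close>

definition order_statistic :: "(nat \<Rightarrow> real) \<Rightarrow> nat \<Rightarrow> real" where
  "order_statistic v i = (SUP J \<in> {J. finite J \<and> card J = i}. Min (v ` J))"

definition poisson_dirichlet :: "real \<Rightarrow> (nat \<Rightarrow> real) measure" where
  "poisson_dirichlet \<theta> =
     distr (PiM UNIV (\<lambda>_. stick_law \<theta>)) (PiM {1..} (\<lambda>_. borel))
       (\<lambda>w. \<lambda>i\<in>{1..}. order_statistic (stick_breaking w) i)"

section \<open>The function \<open>g\<^sub>k\<close> and the limiting expectation\<close>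

text \<open>\<^term>\<open>enumerate\<close> starts at \<open>0\<close>, whereas primes, matrix rows and columns and the
  indices of \<open>L\<close> and \<open>X\<close> are numbered from \<open>1\<close>.\<close>

definition nth_prime :: "nat \<Rightarrow> nat" where
  "nth_prime m = enumerate {p. prime p} (m - 1)"

text \<open>The product in \<open>g\<^sub>k\<close> has integer factors \<open>\<ge> 1\<close>, so it diverges (and \<^const>\<open>prodinf\<close> is
  then an unspecified constant) iff infinitely many factors differ from \<open>1\<close>. For the random
  matrices below this event is a null set.\<close>

definition gfun :: "nat \<Rightarrow> (nat \<Rightarrow> nat \<Rightarrow> nat) \<Rightarrow> real" where
  "gfun k e = (\<Prod>m. real (nth_prime (Suc m)) ^
      ((\<Sum>j\<in>{1..k}. e (Suc m) j) - Max (e (Suc m) ` {1..k})))"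

text \<open>An increasing tuple \<open>i\<^sub>1 < \<dots> < i\<^sub>k\<close> is represented by the set of its entries.\<close>

definition submatrix :: "(nat \<Rightarrow> nat \<Rightarrow> nat) \<Rightarrow> nat set \<Rightarrow> nat \<Rightarrow> nat \<Rightarrow> nat" where
  "submatrix x I m j = x m (sorted_list_of_set I ! (j - 1))"

definition k_subsets :: "nat \<Rightarrow> nat set set" where
  "k_subsets k = {I. I \<subseteq> {1..} \<and> finite I \<and> card I = k}"

text \<open>Unordered infinite product, in analogy to \<^const>\<open>infsum\<close>. It is only used for factors in
  \<open>[0,1]\<close>, where the limit always exists.\<close>

definition infprod :: "('a \<Rightarrow> real) \<Rightarrow> 'a set \<Rightarrow> real" where
  "infprod f A = Lim (finite_subsets_at_top A) (prod f)"

definition gap_expectation ::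
  "'a measure \<Rightarrow> (nat \<Rightarrow> 'a \<Rightarrow> real) \<Rightarrow> (nat \<Rightarrow> nat \<Rightarrow> 'a \<Rightarrow> nat) \<Rightarrow> nat \<Rightarrow> real \<Rightarrow> real \<Rightarrow> real" where
  "gap_expectation M L X k y1 y2 =
     (\<integral>\<omega>. infprod (\<lambda>I. 1 - min ((y2 - y1) * (\<Prod>i\<in>I. L i \<omega>)
                          / gfun k (submatrix (\<lambda>m i. X m i \<omega>) I)) 1)
            (k_subsets k) \<partial>M)"

section \<open>Labelled hypergraphs\<close>

text \<open>Vertices are identified with their labels, and the edges form a multiset of sets.\<close>

type_synonym hgraph = "nat set \<times> nat set multiset"

definition labelled_hypergraph :: "hgraph \<Rightarrow> bool" where
  "labelled_hypergraph H \<longleftrightarrow>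
     fst H \<subseteq> {1..} \<and> (\<forall>e \<in># snd H. e \<noteq> {} \<and> e \<subseteq> fst H)"

definition hyp_B :: "nat \<Rightarrow> nat \<Rightarrow> hgraph set" where
  "hyp_B k m = {H. labelled_hypergraph H
      \<and> size (snd H) = m \<and> (\<forall>e \<in># snd H. count (snd H) e = 1)
      \<and> (\<forall>e \<in># snd H. finite e \<and> card e = k)
      \<and> (\<forall>v \<in> fst H. \<exists>e \<in># snd H. v \<in> e)}"

definition hyp_A :: "nat \<Rightarrow> nat \<Rightarrow> hgraph set" where
  "hyp_A k m = {H \<in> hyp_B k m. \<exists>r. fst H = {1..r}}"

definition label_iso :: "hgraph \<Rightarrow> hgraph \<Rightarrow> bool" where
  "label_iso H G \<longleftrightarrow>
     (\<exists>f. bij_betw f (fst H) (fst G) \<and> strict_mono_on (fst H) f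
        \<and> image_mset ((`) f) (snd H) = snd G)"

definition psi ::
  "'a measure \<Rightarrow> (nat \<Rightarrow> nat \<Rightarrow> 'a \<Rightarrow> nat) \<Rightarrow> nat \<Rightarrow> hgraph \<Rightarrow> real" where
  "psi M X k G =
     (\<integral>\<omega>. (\<Prod>e \<in># snd G. 1 / gfun k (submatrix (\<lambda>m i. X m i \<omega>) e)) \<partial>M)"

definition L_monomial :: "(nat \<Rightarrow> real) \<Rightarrow> hgraph \<Rightarrow> real" where
  "L_monomial l H = (\<Prod>i \<in> fst H. l i ^ size {#e \<in># snd H. i \<in> e#})"

definition EL :: "'a measure \<Rightarrow> (nat \<Rightarrow> 'a \<Rightarrow> real) \<Rightarrow> hgraph \<Rightarrow> real" where
  "EL M L H = (\<integral>\<omega>. L_monomial (\<lambda>i. L i \<omega>) H \<partial>M)"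

text \<open>The sequence \<open>c\<close> consists of the coefficients of a power series \<open>f\<close> with
  \<open>P(y1, y2) = f(y1 - y2)\<close> whenever \<open>0 < y2 - y1 \<le> k^k\<close>.\<close>

definition power_series_rep :: "nat \<Rightarrow> (real \<Rightarrow> real \<Rightarrow> real) \<Rightarrow> (nat \<Rightarrow> real) \<Rightarrow> bool" where
  "power_series_rep k P c \<longleftrightarrow>
     (\<forall>y1 y2. y1 < y2 \<and> y2 - y1 \<le> real k ^ k \<longrightarrow>
        (\<lambda>m. c m * (y1 - y2) ^ m) sums P y1 y2)"

end

theory Submission
  imports Defs "HOL-Complex_Analysis.Cauchy_Integral_Formula"
begin

text \<open>Almost surely \<open>L\<^sub>i \<ge> 0\<close>, \<open>\<Sum>\<^sub>i L\<^sub>i \<le> 1\<close> and \<open>g\<^sub>k \<ge> 1\<close> (Borel-Cantelli). By the inequality of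
  arithmetic and geometric means a product of \<open>k\<close> of the \<open>L\<^sub>i\<close> is at most \<open>1 / k ^ k\<close>, so the
  minimum in the limiting expectation is redundant for \<open>x = y2 - y1 \<le> k ^ k\<close>. Writing \<open>a\<^sub>I\<close> for
  \<open>\<Prod>\<^sub>i L\<^sub>i / g\<^sub>k\<close>, the product of the factors \<open>1 - x a\<^sub>I\<close> expands into the sum over all finite sets
  \<open>S\<close> of \<open>k\<close>-subsets of the products of \<open>- x a\<^sub>I\<close> over \<open>I \<in> S\<close>. The sum of the absolute values is
  \<open>\<Prod>\<^sub>I (1 + x a\<^sub>I) \<le> exp (x \<Sum>\<^sub>I a\<^sub>I)\<close>, and \<open>\<Sum>\<^sub>I a\<^sub>I \<le> \<Prod>\<^sub>i (1 + L\<^sub>i) \<le> exp 1\<close>, so expectation and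
  sum may be exchanged. The sets \<open>S\<close> of size \<open>m\<close> are the hypergraphs with \<open>m\<close> edges, independence
  splits each expectation into \<open>\<psi>\<close> and \<open>E[L\<^sup>H]\<close>, and \<open>\<psi>\<close> only depends on the order type of the
  labels because the columns of \<open>X\<close> are independent and identically distributed.\<close>

section \<open>Infinite products and power series\<close>

text \<open>Summed over all subsets of \<open>U\<close>, the products are the expansion of the
  product of \<open>a x + 1\<close>, and \<open>1 + t \<le> exp t\<close> bounds each
  factor.\<close>

lemma sum_prod_le_exp:
  fixes a :: "'b \<Rightarrow> real"
  assumes U: "finite U" and F: "F \<subseteq> Pow U" and a: "\<And>x. x \<in> U \<Longrightarrow> a x \<ge> 0"
  shows "(\<Sum>S\<in>F. \<Prod>x\<in>S. a x) \<le> exp (\<Sum>x\<in>U. a x)"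
proof -
  have "(\<Sum>S\<in>F. \<Prod>x\<in>S. a x) \<le> (\<Sum>S\<in>Pow U. \<Prod>x\<in>S. a x)"
    using U F a by (intro sum_mono2 prod_nonneg) (auto simp: subset_iff)
  also have "\<dots> = (\<Prod>x\<in>U. a x + 1)"
    using prod_add[OF U, of a "\<lambda>_. 1"] by simp
  also have "\<dots> \<le> (\<Prod>x\<in>U. exp (a x))"
    using a by (intro prod_mono) (auto simp: add.commute intro: add_nonneg_nonneg)
  also have "\<dots> = exp (\<Sum>x\<in>U. a x)"
    using U by (simp add: exp_sum)
  finally show ?thesis .
qed

text \<open>A finite product of \<open>1 + b x\<close> over \<open>F\<close> is the partial sum over
  \<open>Pow F\<close>. These partial sums are cofinal: a finite family of finite sets lies in
  \<open>Pow F\<close> as soon as \<open>F\<close> contains its union.\<close>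

lemma tendsto_prod_one_plus:
  fixes b :: "'b \<Rightarrow> real"
  assumes "((\<lambda>S. \<Prod>x\<in>S. b x) has_sum s) (Fpow A)"
  shows "((\<lambda>F. \<Prod>x\<in>F. 1 + b x) \<longlongrightarrow> s) (finite_subsets_at_top A)"
proof -
  have "filterlim Pow (finite_subsets_at_top (Fpow A)) (finite_subsets_at_top A)"
    unfolding filterlim_iff
  proof (intro allI impI)
    fix P assume "eventually P (finite_subsets_at_top (Fpow A))"
    then obtain Y where Y: "finite Y" "Y \<subseteq> Fpow A"
      "\<And>Z. finite Z \<Longrightarrow> Y \<subseteq> Z \<Longrightarrow> Z \<subseteq> Fpow A \<Longrightarrow> P Z"
      by (auto simp: eventually_finite_subsets_at_top)
    show "\<forall>\<^sub>F F in finite_subsets_at_top A. P (Pow F)"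
      unfolding eventually_finite_subsets_at_top
    proof (intro exI conjI allI impI)
      show "finite (\<Union>Y)" "\<Union>Y \<subseteq> A"
        using Y by (auto simp: Fpow_def)
      fix Z assume "finite Z \<and> \<Union>Y \<subseteq> Z \<and> Z \<subseteq> A"
      then show "P (Pow Z)"
        by (intro Y(3)) (auto simp: Fpow_def intro: finite_subset)
    qed
  qed
  with assms have "((\<lambda>F. \<Sum>S\<in>Pow F. \<Prod>x\<in>S. b x) \<longlongrightarrow> s) (finite_subsets_at_top A)"
    unfolding has_sum_def by (rule filterlim_compose)
  moreover have "\<forall>\<^sub>F F in finite_subsets_at_top A.
      (\<Sum>S\<in>Pow F. \<Prod>x\<in>S. b x) = (\<Prod>x\<in>F. 1 + b x)"
  proof (rule eventually_finite_subsets_at_top_weakI)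
    fix F :: "'b set" assume "finite F"
    then show "(\<Sum>S\<in>Pow F. \<Prod>x\<in>S. b x) = (\<Prod>x\<in>F. 1 + b x)"
      using prod_add[of F b "\<lambda>_. 1"] by (simp add: add.commute)
  qed
  ultimately show ?thesis
    by (rule Lim_transform_eventually)
qed

text \<open>Turns a limit along finite subsets into a limit of a sequence, for which closure of
  measurability under limits is available.\<close>

lemma filterlim_enumeration_finite_subsets_at_top:
  assumes "countable A" "infinite A"
  shows "filterlim (\<lambda>n. from_nat_into A ` {..<n}) (finite_subsets_at_top A) sequentially"
  unfolding filterlim_iff
proof (intro allI impI)
  fix P assume "eventually P (finite_subsets_at_top A)"
  then obtain Y where Y: "finite Y" "Y \<subseteq> A"
    "\<And>Z. finite Z \<Longrightarrow> Y \<subseteq> Z \<Longrightarrow> Z \<subseteq> A \<Longrightarrow> P Z"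
    by (auto simp: eventually_finite_subsets_at_top)
  have "finite (to_nat_on A ` Y)" using Y by simp
  then obtain N where N: "\<And>y. y \<in> Y \<Longrightarrow> to_nat_on A y < N"
    by (meson finite_nat_set_iff_bounded image_eqI)
  show "\<forall>\<^sub>F n in sequentially. P (from_nat_into A ` {..<n})"
    unfolding eventually_sequentially
  proof (intro exI allI impI Y(3))
    fix n assume n: "N \<le> n"
    show "Y \<subseteq> from_nat_into A ` {..<n}"
    proof
      fix y assume y: "y \<in> Y"
      then have "y = from_nat_into A (to_nat_on A y)"
        using Y assms by auto
      then show "y \<in> from_nat_into A ` {..<n}"
        using N[OF y] n by (intro image_eqI) auto
    qed
    show "from_nat_into A ` {..<n} \<subseteq> A"
      using assms by (auto intro!: from_nat_into)
  qed auto
qed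

text \<open>Completeness of the reals removes the limit from the statement. The remaining
  quantifiers range over the naturals and \<open>Fpow A\<close>, which is countable whenever
  \<open>A\<close> is.\<close>

lemma convergent_finite_subsets_iff_Cauchy:
  fixes f :: "'b set \<Rightarrow> real"
  shows "(\<exists>l. (f \<longlongrightarrow> l) (finite_subsets_at_top A)) \<longleftrightarrow>
    (\<forall>n. \<exists>F\<in>Fpow A. \<forall>G\<in>Fpow A. F \<subseteq> G \<longrightarrow> \<bar>f G - f F\<bar> < 1 / real (Suc n))"
    (is "?L \<longleftrightarrow> ?R")
proof
  assume ?L
  then obtain l where l: "(f \<longlongrightarrow> l) (finite_subsets_at_top A)" ..
  show ?R
  proof
    fix n
    have "\<forall>\<^sub>F F in finite_subsets_at_top A. dist (f F) l < 1 / real (Suc n) / 2"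
      using l by (rule tendstoD) simp
    then obtain F where F: "finite F" "F \<subseteq> A"
      "\<And>G. finite G \<Longrightarrow> F \<subseteq> G \<Longrightarrow> G \<subseteq> A \<Longrightarrow> dist (f G) l < 1 / real (Suc n) / 2"
      by (auto simp: eventually_finite_subsets_at_top)
    show "\<exists>F\<in>Fpow A. \<forall>G\<in>Fpow A. F \<subseteq> G \<longrightarrow> \<bar>f G - f F\<bar> < 1 / real (Suc n)"
    proof (intro bexI[of _ F] ballI impI)
      fix G assume "G \<in> Fpow A" "F \<subseteq> G"
      then show "\<bar>f G - f F\<bar> < 1 / real (Suc n)"
        using F(3)[of G] F(3)[of F] F(1,2) dist_triangle_half_l[of "f G" l "1 / real (Suc n)" "f F"]
        by (auto simp: Fpow_def dist_real_def abs_minus_commute)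
    qed (use F in \<open>auto simp: Fpow_def\<close>)
  qed
next
  assume R: ?R
  have "cauchy_filter (filtermap f (finite_subsets_at_top A))"
    unfolding cauchy_filter_metric_filtermap
  proof (intro allI impI)
    fix e :: real assume e: "e > 0"
    obtain n where n: "1 / real (Suc n) < e / 2"
      using reals_Archimedean[of "e/2"] e by (auto simp: inverse_eq_divide)
    obtain F where F: "F \<in> Fpow A"
      "\<forall>G\<in>Fpow A. F \<subseteq> G \<longrightarrow> \<bar>f G - f F\<bar> < 1 / real (Suc n)"
      using spec[OF R, of n] by (rule bexE)
    show "\<exists>P. eventually P (finite_subsets_at_top A) \<and> (\<forall>x y. P x \<and> P y \<longrightarrow> dist (f x) (f y) < e)"
    proof (intro exI conjI allI impI)
      show "\<forall>\<^sub>F G in finite_subsets_at_top A. G \<in> Fpow A \<and> F \<subseteq> G"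
        using F(1) unfolding eventually_finite_subsets_at_top
        by (intro exI[of _ F]) (auto simp: Fpow_def)
      fix G H assume "(G \<in> Fpow A \<and> F \<subseteq> G) \<and> (H \<in> Fpow A \<and> F \<subseteq> H)"
      then have "\<bar>f G - f F\<bar> < e/2" "\<bar>f H - f F\<bar> < e/2"
        using bspec[OF F(2), of G] bspec[OF F(2), of H] n by linarith+
      then show "dist (f G) (f H) < e"
        unfolding dist_real_def by linarith
    qed
  qed
  then obtain l where "filtermap f (finite_subsets_at_top A) \<le> nhds l"
    using complete_UNIV[where ?'a = real, unfolded complete_uniform, rule_format,
        of "filtermap f (finite_subsets_at_top A)"]
    by (auto simp: filtermap_bot_iff)
  then show ?L
    by (auto simp: filterlim_def)
qed

text \<open>Off the event of convergence, \<^const>\<open>infprod\<close> is one fixed unspecified constant, and by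
  the Cauchy criterion over the countably many finite subsets that event is measurable.\<close>

lemma borel_measurable_infprod:
  fixes f :: "'b \<Rightarrow> 'a \<Rightarrow> real"
  assumes A: "countable A" "infinite A"
    and f [measurable]: "\<And>i. i \<in> A \<Longrightarrow> f i \<in> borel_measurable M"
  shows "(\<lambda>x. infprod (\<lambda>i. f i x) A) \<in> borel_measurable M"
proof -
  define C where "C x \<longleftrightarrow> (\<forall>n. \<exists>F\<in>Fpow A. \<forall>G\<in>Fpow A. F \<subseteq> G \<longrightarrow>
      \<bar>(\<Prod>i\<in>G. f i x) - (\<Prod>i\<in>F. f i x)\<bar> < 1 / real (Suc n))" for x
  define p where "p n x = (\<Prod>i\<in>from_nat_into A ` {..<n}. f i x)" for n x
  have eq: "infprod (\<lambda>i. f i x) A = (if C x then lim (\<lambda>n. p n x) else (THE l. False))" for x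
  proof (cases "C x")
    case True
    then obtain l where l: "(prod (\<lambda>i. f i x) \<longlongrightarrow> l) (finite_subsets_at_top A)"
      unfolding C_def convergent_finite_subsets_iff_Cauchy[of "prod (\<lambda>i. f i x)", symmetric]
      by blast
    then have "(\<lambda>n. p n x) \<longlonglongrightarrow> l"
      unfolding p_def
      using filterlim_compose[OF l filterlim_enumeration_finite_subsets_at_top[OF A]]
      by simp
    moreover have "infprod (\<lambda>i. f i x) A = l"
      unfolding infprod_def using l by (intro tendsto_Lim) auto
    ultimately show ?thesis using True by (simp add: limI)
  next
    case False
    then have "\<And>l. (prod (\<lambda>i. f i x) \<longlongrightarrow> l) (finite_subsets_at_top A) \<longleftrightarrow> False"
      unfolding C_def convergent_finite_subsets_iff_Cauchy[of "prod (\<lambda>i. f i x)", symmetric]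
      by blast
    then show ?thesis using False by (simp add: infprod_def t2_space_class.Lim_def)
  qed
  have [measurable]: "p n \<in> borel_measurable M" for n
    unfolding p_def using A by (intro borel_measurable_prod) (auto intro!: f from_nat_into)
  have cF: "countable (Fpow A)"
    using countable_Fpow[OF A(1)] .
  have mp: "(\<lambda>x. \<Prod>i\<in>G. f i x) \<in> borel_measurable M" if "G \<in> Fpow A" for G
    using that by (intro borel_measurable_prod) (auto simp: Fpow_def)
  have mC: "{x\<in>space M. C x} \<in> sets M"
    unfolding C_def
  proof (intro sets.sets_Collect_countable_All sets.sets_Collect_countable_Ex'[OF _ cF]
      sets.sets_Collect_countable_All'[OF _ cF] sets.sets_Collect_imp sets.sets_Collect_const)
    fix F G n assume [measurable]: "F \<in> Fpow A" "G \<in> Fpow A"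
    note [measurable] = mp
    show "{x \<in> space M. \<bar>(\<Prod>i\<in>G. f i x) - (\<Prod>i\<in>F. f i x)\<bar> < 1 / real (Suc n)} \<in> sets M"
      using mp[OF \<open>F \<in> _\<close>] mp[OF \<open>G \<in> _\<close>] by measurable
  qed
  have [measurable]: "(\<lambda>x. lim (\<lambda>n. p n x)) \<in> borel_measurable M"
    by (rule borel_measurable_lim_metric) auto
  show ?thesis
    unfolding eq using mC by (intro measurable_If) auto
qed

lemma infprod_cong:
  assumes "\<And>i. i \<in> A \<Longrightarrow> f i = g i"
  shows "infprod f A = infprod g A"
proof -
  have "\<forall>\<^sub>F F in finite_subsets_at_top A. prod f F = prod g F"
    using assms by (intro eventually_finite_subsets_at_top_weakI prod.cong) auto
  then show ?thesis
    unfolding infprod_def t2_space_class.Lim_def by (simp add: tendsto_cong)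
qed

text \<open>The gap probability provides values only at negative arguments, so uniqueness has to
  come from one side of 0. A power series with a nonzero coefficient has no zeros in some punctured
  disc, whereas the difference of the two series vanishes on \<open>[-r, 0)\<close>.\<close>

lemma powser_coeff_unique_left:
  fixes c d :: "nat \<Rightarrow> real"
  assumes r: "r > 0"
    and c: "\<And>x. -r \<le> x \<Longrightarrow> x < 0 \<Longrightarrow> (\<lambda>n. c n * x ^ n) sums P x"
    and d: "\<And>x. -r \<le> x \<Longrightarrow> x < 0 \<Longrightarrow> (\<lambda>n. d n * x ^ n) sums P x"
  shows "c = d"
proof (rule ccontr)
  assume "c \<noteq> d"
  then obtain m where m: "c m \<noteq> d m" by auto
  define e where "e n = c n - d n" for n
  have e: "(\<lambda>n. e n * x ^ n) sums 0" if "-r \<le> x" "x < 0" for x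
    using sums_diff[OF c[OF that] d[OF that]] by (simp add: e_def left_diff_distrib)
  \<comment> \<open>The shift makes the constant coefficient vanish, as \<open>powser_0_nonzero\<close> requires.\<close>
  define a where "a n = (if n = 0 then 0 else e (n - 1))" for n
  have a: "(\<lambda>n. a n * (x - 0) ^ n) sums (x * (\<Sum>n. e n * x ^ n))" if "norm (x - 0) < r" for x
  proof -
    \<comment> \<open>Convergence at the endpoint \<open>-r\<close> gives convergence in the whole
      open disc, positive arguments included.\<close>
    have "summable (\<lambda>n. e n * (-r) ^ n)"
      using e[of "-r"] r by (intro sums_summable) auto
    then have "summable (\<lambda>n. e n * x ^ n)"
      by (rule powser_inside) (use r that in auto)
    then have "(\<lambda>n. x * (e n * x ^ n)) sums (x * (\<Sum>n. e n * x ^ n))"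
      by (intro sums_mult summable_sums)
    then have "(\<lambda>n. a (Suc n) * x ^ (Suc n)) sums (x * (\<Sum>n. e n * x ^ n))"
      by (simp add: a_def mult_ac)
    then have "(\<lambda>n. a n * x ^ n) sums (x * (\<Sum>n. e n * x ^ n) + a 0 * x ^ 0)"
      by (rule sums_Suc)
    then show ?thesis
      by (simp add: a_def)
  qed
  have am: "a (Suc m) \<noteq> 0" using m by (simp add: a_def e_def)
  show False
  proof (rule powser_0_nonzero[where \<xi> = 0 and f = "\<lambda>x. x * (\<Sum>n. e n * x ^ n)",
          OF r a mult_zero_left am zero_less_Suc])
    fix s :: real
    assume s: "s > 0" "\<And>z. z \<in> cball 0 s - {0} \<Longrightarrow> z * (\<Sum>n. e n * z ^ n) \<noteq> 0"
    \<comment> \<open>A negative point lying both in the zero-free disc of radius \<open>s\<close>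
      and in the interval on which the difference vanishes.\<close>
    define z where "z = - min s r"
    have "(\<Sum>n. e n * z ^ n) = 0"
      using e[of z] s(1) r by (auto simp: z_def sums_iff)
    then show False
      using s(2)[of z] s(1) r by (auto simp: z_def min_def split: if_splits)
  qed
qed

section \<open>The Poisson-Dirichlet distribution\<close>

lemma sum_stick_breaking: "(\<Sum>j<n. stick_breaking w j) = 1 - (\<Prod>j<n. 1 - w j)"
  by (induction n) (simp_all add: stick_breaking_def algebra_simps)

lemma stick_breaking_nonneg:
  assumes "\<And>j. w j \<in> {0..1}"
  shows "stick_breaking w j \<ge> 0"
  using assms by (auto simp: stick_breaking_def intro!: mult_nonneg_nonneg prod_nonneg)

text \<open>The sum over an initial segment telescopes to 1 minus the length of the stick that is
  left, and that length is nonnegative.\<close>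

lemma sum_stick_breaking_le_1:
  assumes w: "\<And>j. w j \<in> {0..1}" and F: "finite F"
  shows "(\<Sum>j\<in>F. stick_breaking w j) \<le> 1"
proof -
  obtain n where n: "F \<subseteq> {..<n}"
    using F by (auto simp: finite_nat_iff_bounded)
  have "(\<Sum>j\<in>F. stick_breaking w j) \<le> (\<Sum>j<n. stick_breaking w j)"
    using n stick_breaking_nonneg[OF w] by (intro sum_mono2) auto
  also have "\<dots> \<le> 1"
    unfolding sum_stick_breaking using w by (simp add: prod_nonneg)
  finally show ?thesis .
qed

section \<open>Bounds and measurability of order statistics\<close>

lemma countable_finite_card_eq: "countable {J :: nat set. finite J \<and> card J = i}"
  by (rule countable_subset[OF _ countable_Collect_finite]) auto

lemma finite_card_eq_nonempty: "{J :: nat set. finite J \<and> card J = i} \<noteq> {}"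
  using finite_lessThan card_lessThan by blast

lemma Min_image_bounds:
  fixes v :: "nat \<Rightarrow> real"
  assumes "\<And>j. v j \<in> {0..1}" "finite J" "card J = i" "i \<ge> 1"
  shows "Min (v ` J) \<in> {0..1}"
proof -
  have "Min (v ` J) \<in> v ` J"
    using assms by (intro Min_in) auto
  then show ?thesis using assms by auto
qed

lemma bdd_above_order_statistic:
  fixes v :: "nat \<Rightarrow> real"
  assumes "\<And>j. v j \<in> {0..1}" "i \<ge> 1"
  shows "bdd_above ((\<lambda>J. Min (v ` J)) ` {J. finite J \<and> card J = i})"
  using Min_image_bounds[OF assms(1) _ _ assms(2)] by (intro bdd_aboveI[of _ 1]) auto

lemma order_statistic_nonneg:
  fixes v :: "nat \<Rightarrow> real"
  assumes "\<And>j. v j \<in> {0..1}" "i \<ge> 1"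
  shows "order_statistic v i \<ge> 0"
proof -
  have "0 \<le> Min (v ` {..<i})"
    using Min_image_bounds[OF assms(1) _ _ assms(2), of "{..<i}"] by auto
  also have "\<dots> \<le> order_statistic v i"
    unfolding order_statistic_def
    by (rule cSUP_upper[OF _ bdd_above_order_statistic[OF assms]]) auto
  finally show ?thesis .
qed

text \<open>Distinct indices are chosen whose terms reach the successive order statistics up to an
  error \<open>d\<close>, so the sum is compared with a finite sum of terms of \<open>v\<close>. The
  error avoids the question whether the suprema are attained.\<close>

lemma sum_order_statistic_le:
  fixes v :: "nat \<Rightarrow> real"
  assumes v: "\<And>j. v j \<ge> 0" and B: "\<And>F. finite F \<Longrightarrow> (\<Sum>j\<in>F. v j) \<le> 1"
  shows "(\<Sum>i\<in>{1..n}. order_statistic v i) \<le> 1"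
proof (rule field_le_epsilon)
  fix e :: real assume e: "e > 0"
  define d where "d = e / real (Suc n)"
  have d: "d > 0" using e by (simp add: d_def)
  \<comment> \<open>Greedy choice: an index set of size \<open>m + 1\<close> always contains an index not used so far.\<close>
  have "\<exists>F. finite F \<and> card F = m \<and> (\<Sum>i\<in>{1..m}. order_statistic v i - d) \<le> (\<Sum>j\<in>F. v j)" for m
  proof (induction m)
    case 0
    show ?case by (rule exI[of _ "{}"]) simp
  next
    case (Suc m)
    then obtain F where F: "finite F" "card F = m"
      "(\<Sum>i\<in>{1..m}. order_statistic v i - d) \<le> (\<Sum>j\<in>F. v j)" by blast
    have "order_statistic v (Suc m) - d < order_statistic v (Suc m)" using d by simp
    then have "\<exists>y\<in>(\<lambda>J. Min (v ` J)) ` {J. finite J \<and> card J = Suc m}.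
        order_statistic v (Suc m) - d < y"
      using finite_card_eq_nonempty
      by (intro less_cSupD) (auto simp: order_statistic_def)
    then obtain J where J: "finite J" "card J = Suc m"
      "order_statistic v (Suc m) - d < Min (v ` J)"
      by blast
    have "\<not> J \<subseteq> F"
      using card_mono[OF F(1), of J] F J by auto
    then obtain j where j: "j \<in> J" "j \<notin> F" by auto
    have "Min (v ` J) \<le> v j" using J j by simp
    with J have "order_statistic v (Suc m) - d \<le> v j" by linarith
    then show ?case
      using F j by (intro exI[of _ "insert j F"]) (simp add: add.commute add_mono)
  qed
  from this[of n] obtain F where F: "finite F"
    "(\<Sum>i\<in>{1..n}. order_statistic v i - d) \<le> (\<Sum>j\<in>F. v j)" by blast
  have "(\<Sum>i\<in>{1..n}. order_statistic v i) = (\<Sum>i\<in>{1..n}. order_statistic v i - d) + real n * d"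
    by (simp add: sum_subtractf)
  also have "\<dots> \<le> 1 + e"
  proof (rule add_mono)
    show "(\<Sum>i\<in>{1..n}. order_statistic v i - d) \<le> 1" using F B[of F] by linarith
    show "real n * d \<le> e" using e by (simp add: d_def field_simps)
  qed
  finally show "(\<Sum>i\<in>{1..n}. order_statistic v i) \<le> 1 + e" .
qed

text \<open>Off the event that the supremum is bounded, \<^const>\<open>Sup\<close> on the reals is one fixed
  unspecified constant, so no boundedness is needed.\<close>

lemma borel_measurable_cSUP_total:
  fixes f :: "'i \<Rightarrow> 'a \<Rightarrow> real"
  assumes I: "countable I" "I \<noteq> {}" and f: "\<And>i. i \<in> I \<Longrightarrow> f i \<in> borel_measurable M"
  shows "(\<lambda>x. SUP i\<in>I. f i x) \<in> borel_measurable M"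
proof -
  define C where "C x \<longleftrightarrow> (\<exists>n::nat. \<forall>i\<in>I. f i x \<le> real n)" for x
  have C: "C x \<longleftrightarrow> bdd_above ((\<lambda>i. f i x) ` I)" for x
  proof
    assume "bdd_above ((\<lambda>i. f i x) ` I)"
    then obtain b where b: "\<And>i. i \<in> I \<Longrightarrow> f i x \<le> b" by (auto simp: bdd_above_def)
    obtain n where "b \<le> real n" using real_arch_simple by blast
    with b show "C x" unfolding C_def by (meson order_trans)
  qed (auto simp: C_def bdd_above_def)
  have mC: "{x\<in>space M. C x} \<in> sets M"
    unfolding C_def
    by (intro sets.sets_Collect_countable_Ex sets.sets_Collect_countable_All'[OF _ I(1)]
        borel_measurable_le f) auto
  \<comment> \<open>Replacing \<open>f\<close> by 0 off the event of boundedness makes every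
    supremum bounded, so that the standard measurability result for suprema applies.\<close>
  define g where "g i x = (if C x then f i x else 0)" for i x
  have g: "g i \<in> borel_measurable M" if "i \<in> I" for i
    unfolding g_def using mC f[OF that] by (intro measurable_If) auto
  have mg: "(\<lambda>x. SUP i\<in>I. g i x) \<in> borel_measurable M"
    by (rule borel_measurable_cSUP[OF I(1) g]) (auto simp: g_def C)
  have "(SUP i\<in>I. f i x) = (if C x then SUP i\<in>I. g i x else (LEAST z::real. False))" for x
  proof (cases "C x")
    case False
    \<comment> \<open>\<open>Sup\<close> on the reals is the least upper bound given by
      \<open>LEAST\<close>. Without upper bounds the predicate is constantly false, and the value no
      longer depends on \<open>x\<close>.\<close>
    have "(LEAST z. \<forall>y\<in>(\<lambda>i. f i x) ` I. y \<le> z) = (LEAST z::real. False)"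
      using False by (intro arg_cong[where f = Least]) (auto simp: C bdd_above_def fun_eq_iff)
    then show ?thesis using False by (simp add: Sup_real_def)
  qed (simp add: g_def)
  then show ?thesis
    using mC mg by (simp add: measurable_If)
qed

lemma borel_measurable_order_statistic:
  fixes v :: "nat \<Rightarrow> 'a \<Rightarrow> real"
  assumes v: "\<And>j. v j \<in> borel_measurable M" and i: "i \<ge> 1"
  shows "(\<lambda>x. order_statistic (\<lambda>j. v j x) i) \<in> borel_measurable M"
  unfolding order_statistic_def
proof (rule borel_measurable_cSUP_total[OF countable_finite_card_eq finite_card_eq_nonempty])
  fix J :: "nat set" assume "J \<in> {J. finite J \<and> card J = i}"
  then show "(\<lambda>x. Min ((\<lambda>j. v j x) ` J)) \<in> borel_measurable M"
    using i v by (intro borel_measurable_Min) auto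
qed

section \<open>The law of the sticks and almost sure bounds under the Poisson-Dirichlet law\<close>

lemma prob_space_stick_law:
  assumes "\<theta> > 0"
  shows "prob_space (stick_law \<theta>)"
proof -
  have "((\<lambda>x. x powr (\<theta> - 1)) has_integral (1 / \<theta>)) {0..1}"
    using has_integral_powr_from_0[of "\<theta> - 1" 1] assms by simp
  \<comment> \<open>The reflection of \<open>x\<close> to \<open>1 - x\<close> maps the unit
    interval to itself.\<close>
  then have "((\<lambda>x. (1 - x) powr (\<theta> - 1)) has_integral (1 / \<theta>)) {0..1::real}"
    using has_integral_affinity[of "\<lambda>x::real. x powr (\<theta> - 1)" "1 / \<theta>" 0 1 "-1" 1]
    by (simp add: image_affinity_atLeastAtMost)
  then have "((\<lambda>x. \<theta> * (1 - x) powr (\<theta> - 1)) has_integral 1) {0..1::real}"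
    using has_integral_mult_right[of _ "1 / \<theta>" "{0..1::real}" \<theta>] assms by simp
  then have "(\<integral>\<^sup>+x. ennreal (indicator {0..1} x * (\<theta> * (1 - x) powr (\<theta> - 1))) \<partial>lborel) = 1"
    using assms
    by (subst nn_integral_has_integral_lebesgue[where I = 1]) auto
  then show ?thesis
    unfolding stick_law_def by (intro prob_spaceI) (simp add: emeasure_density)
qed

lemma AE_stick_law: "AE x in stick_law \<theta>. x \<in> {0..1}"
  unfolding stick_law_def by (subst AE_density) (auto simp: indicator_def)

lemma sets_stick_law [measurable_cong]: "sets (stick_law \<theta>) = sets borel"
  by (simp add: stick_law_def)

text \<open>Almost surely all \<open>w j\<close> lie in the unit interval. The bounds then pass from
  the stick-breaking weights to their order statistics and along the image measure; all later
  estimates on \<open>L\<close> rest on them.\<close>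

lemma AE_poisson_dirichlet:
  assumes "\<theta> > 0"
  shows "AE l in poisson_dirichlet \<theta>. \<forall>n. l (Suc n) \<ge> 0 \<and> (\<Sum>i\<in>{1..n}. l i) \<le> 1"
proof -
  let ?S = "PiM UNIV (\<lambda>_::nat. stick_law \<theta>)"
  let ?P = "PiM {1::nat..} (\<lambda>_. borel :: real measure)"
  have comp: "(\<lambda>w. w j) \<in> borel_measurable ?S" for j
    using measurable_component_singleton[of j UNIV "\<lambda>_. stick_law \<theta>"]
      measurable_cong_sets[OF refl sets_stick_law] by blast
  note [measurable] = comp
  have ms: "(\<lambda>w. stick_breaking w j) \<in> borel_measurable ?S" for j
    unfolding stick_breaking_def by measurable
  have m: "(\<lambda>w. \<lambda>i\<in>{1..}. order_statistic (stick_breaking w) i) \<in> measurable ?S ?P"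
    by (intro measurable_restrict borel_measurable_order_statistic ms) auto
  have "AE w in ?S. \<forall>j. w j \<in> {0..1}"
    unfolding AE_all_countable
    by (intro allI AE_PiM_component prob_space_stick_law assms AE_stick_law) auto
  then have "AE w in ?S. \<forall>n. (\<lambda>i\<in>{1..}. order_statistic (stick_breaking w) i) (Suc n) \<ge> 0 \<and>
      (\<Sum>i\<in>{1..n}. (\<lambda>i\<in>{1..}. order_statistic (stick_breaking w) i) i) \<le> 1"
  proof eventually_elim
    case (elim w)
    then have w: "\<And>j. w j \<in> {0..1}" by blast
    have v1: "stick_breaking w j \<in> {0..1}" for j
      using stick_breaking_nonneg[OF w] sum_stick_breaking_le_1[OF w, of "{j}"] by simp
    show ?case
      using order_statistic_nonneg[OF v1] sum_order_statistic_le[of "stick_breaking w"]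
        stick_breaking_nonneg[OF w] sum_stick_breaking_le_1[OF w] by auto
  qed
  moreover have "{l \<in> space ?P. \<forall>n. l (Suc n) \<ge> 0 \<and> (\<Sum>i\<in>{1..n}. l i) \<le> 1} \<in> sets ?P"
    by (intro sets.sets_Collect_countable_All sets.sets_Collect_conj borel_measurable_le
        borel_measurable_sum measurable_component_singleton) auto
  ultimately show ?thesis
    unfolding poisson_dirichlet_def using m by (subst AE_distr_iff) auto
qed

section \<open>The function \<open>g\<^sub>k\<close>\<close>

text \<open>\<open>has_prod\<close> tolerates finitely many zero factors but demands a nonzero limit
  of the remaining ones. Factors of at least 1 rule out both zero factors and a zero limit, so it
  coincides with convergence of the partial products.\<close>

lemma prodinf_eq_lim:
  fixes f :: "nat \<Rightarrow> real"
  assumes f: "\<And>m. f m \<ge> 1"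
  shows "prodinf f = lim (\<lambda>n. \<Prod>i\<le>n. f i)"
proof -
  have nz: "f i \<noteq> 0" for i using f[of i] by auto
  have "f has_prod p \<longleftrightarrow> (\<lambda>n. \<Prod>i\<le>n. f i) \<longlonglongrightarrow> p" for p
  proof
    assume "(\<lambda>n. \<Prod>i\<le>n. f i) \<longlonglongrightarrow> p"
    moreover from this have "p \<ge> 1"
      by (rule LIMSEQ_le_const) (auto intro!: prod_ge_1 f)
    ultimately show "f has_prod p"
      by (auto simp: has_prod_def raw_has_prod_def)
  qed (auto simp: has_prod_def raw_has_prod_def nz)
  then show ?thesis by (simp add: prodinf_def lim_def)
qed

text \<open>The crude growth bound is enough to make the inverse squares of the primes summable in
  the Borel-Cantelli argument.\<close>

lemma nth_prime_Suc: "prime (nth_prime (Suc m))" "m \<le> nth_prime (Suc m)"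
  using enumerate_in_set[OF primes_infinite, of m] le_enumerate[OF primes_infinite, of m]
  by (auto simp: nth_prime_def)

lemma nth_prime_Suc_ge_1: "real (nth_prime (Suc m)) \<ge> 1"
  using prime_ge_1_nat[OF nth_prime_Suc(1)[of m]] by simp

text \<open>Valid also for divergent products: both sides are then the same unspecified constant.\<close>

lemma gfun_eq_lim:
  "gfun k e = lim (\<lambda>n. \<Prod>m\<le>n. real (nth_prime (Suc m)) ^
      ((\<Sum>j\<in>{1..k}. e (Suc m) j) - Max (e (Suc m) ` {1..k})))"
  unfolding gfun_def by (intro prodinf_eq_lim one_le_power nth_prime_Suc_ge_1)

lemma gfun_cong:
  assumes "\<And>m j. j \<in> {1..k} \<Longrightarrow> e (Suc m) j = e' (Suc m) j"
  shows "gfun k e = gfun k e'"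
proof -
  have "e (Suc m) ` {1..k} = e' (Suc m) ` {1..k}" for m
    using assms by (intro image_cong) auto
  then show ?thesis unfolding gfun_def using assms by simp
qed

text \<open>With truncated subtraction on the naturals this inequality makes the exponent of a prime
  in \<open>gfun\<close> equal to 0.\<close>

lemma sum_le_Max_if_at_most_one_nonzero:
  fixes e :: "nat \<Rightarrow> nat"
  assumes "finite A" "\<And>i j. i \<in> A \<Longrightarrow> j \<in> A \<Longrightarrow> i \<noteq> j \<Longrightarrow> e i = 0 \<or> e j = 0"
  shows "(\<Sum>j\<in>A. e j) \<le> Max (e ` A)"
proof (cases "\<exists>i\<in>A. e i \<noteq> 0")
  case True
  then obtain i where i: "i \<in> A" "e i \<noteq> 0" by blast
  then have "\<forall>j\<in>A - {i}. e j = 0"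
    using assms(2)[of i] by fastforce
  then have "(\<Sum>j\<in>A. e j) = (\<Sum>j\<in>{i}. e j)"
    using i assms(1) by (intro sum.mono_neutral_right) auto
  then show ?thesis using i assms(1) by simp
qed simp

text \<open>The almost sure event on which, for every \<open>k\<close>-subset, all but finitely many
  factors of \<open>gfun\<close> are 1. It speaks of pairs of columns so that Borel-Cantelli applies
  to each pair and countability combines the pairs.\<close>

definition sparse_columns :: "(nat \<Rightarrow> nat \<Rightarrow> nat) \<Rightarrow> bool" where
  "sparse_columns x \<longleftrightarrow> (\<forall>i j. i \<noteq> j \<longrightarrow>
     (\<forall>\<^sub>F m in sequentially. x (Suc m) (Suc i) = 0 \<or> x (Suc m) (Suc j) = 0))"

lemma nth_sorted_list_of_k_subset:
  assumes "I \<in> k_subsets k" "j \<in> {1..k}"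
  shows "sorted_list_of_set I ! (j - 1) \<in> I"
proof -
  have "finite I" "card I = k" using assms by (auto simp: k_subsets_def)
  then have "sorted_list_of_set I ! (j - 1) \<in> set (sorted_list_of_set I)"
    using assms by (intro nth_mem) auto
  then show ?thesis using \<open>finite I\<close> by simp
qed

text \<open>Any two of the finitely many columns in \<open>I\<close> are eventually not both
  nonzero, so from some row on every factor is 1. The infinite product is then a finite product of
  factors that are at least 1.\<close>

lemma gfun_submatrix_ge_1:
  assumes x: "sparse_columns x" and I: "I \<in> k_subsets k"
  shows "gfun k (submatrix x I) \<ge> 1"
proof -
  let ?f = "\<lambda>m. real (nth_prime (Suc m)) ^
      ((\<Sum>j\<in>{1..k}. submatrix x I (Suc m) j) - Max (submatrix x I (Suc m) ` {1..k}))"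
  have I': "finite I" "card I = k" "I \<subseteq> {1..}" using I by (auto simp: k_subsets_def)
  have "\<forall>\<^sub>F m in sequentially. \<forall>i\<in>I. \<forall>j\<in>I. i \<noteq> j \<longrightarrow> x (Suc m) i = 0 \<or> x (Suc m) j = 0"
  proof (intro eventually_ball_finite I' ballI)
    fix i j assume "i \<in> I" "j \<in> I"
    then obtain i' j' where "i = Suc i'" "j = Suc j'"
      using I' by (metis atLeast_iff not0_implies_Suc not_one_le_zero subsetD)
    then show "\<forall>\<^sub>F m in sequentially. i \<noteq> j \<longrightarrow> x (Suc m) i = 0 \<or> x (Suc m) j = 0"
      using x by (cases "i = j") (auto simp: sparse_columns_def)
  qed
  then have "\<forall>\<^sub>F m in sequentially. ?f m = 1"
  proof eventually_elim
    case (elim m)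
    have "(\<Sum>j\<in>{1..k}. submatrix x I (Suc m) j) \<le> Max (submatrix x I (Suc m) ` {1..k})"
    proof (rule sum_le_Max_if_at_most_one_nonzero)
      fix i j assume ij: "i \<in> {1..k}" "j \<in> {1..k}" "i \<noteq> j"
      then have "sorted_list_of_set I ! (i - 1) \<noteq> sorted_list_of_set I ! (j - 1)"
        using I' by (subst nth_eq_iff_index_eq) auto
      with bspec[OF bspec[OF elim nth_sorted_list_of_k_subset[OF I ij(1)]]
          nth_sorted_list_of_k_subset[OF I ij(2)]]
      show "submatrix x I (Suc m) i = 0 \<or> submatrix x I (Suc m) j = 0"
        unfolding submatrix_def by simp
    qed simp
    then show ?case by simp
  qed
  then obtain N where N: "\<And>m. m \<ge> N \<Longrightarrow> ?f m = 1"
    by (auto simp: eventually_sequentially)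
  have ge: "(\<Prod>m\<le>n. ?f m) \<ge> 1" for n
    by (intro prod_ge_1 one_le_power nth_prime_Suc_ge_1)
  have "(\<Prod>m\<le>n. ?f m) = (\<Prod>m\<le>N. ?f m)" if "n \<ge> N" for n
    using that N by (intro prod.mono_neutral_right) auto
  then have "(\<lambda>n. \<Prod>m\<le>n. ?f m) \<longlonglongrightarrow> (\<Prod>m\<le>N. ?f m)"
    by (intro tendsto_eventually eventually_sequentiallyI[of N])
  then have "gfun k (submatrix x I) = (\<Prod>m\<le>N. ?f m)"
    unfolding gfun_eq_lim by (rule limI)
  then show ?thesis using ge[of N] by simp
qed

lemma borel_measurable_gfun_submatrix:
  fixes X :: "nat \<Rightarrow> nat \<Rightarrow> 'a \<Rightarrow> nat"
  assumes I: "I \<in> k_subsets k"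
    and X: "\<And>m i. m \<ge> 1 \<Longrightarrow> i \<in> I \<Longrightarrow> X m i \<in> measurable M (count_space UNIV)"
  shows "(\<lambda>\<omega>. gfun k (submatrix (\<lambda>m i. X m i \<omega>) I)) \<in> borel_measurable M"
  unfolding gfun_eq_lim submatrix_def
proof (intro borel_measurable_lim_metric borel_measurable_prod)
  fix m
  let ?e = "\<lambda>j. X (Suc m) (sorted_list_of_set I ! (j - 1))"
  \<comment> \<open>The closure rules for \<open>Max\<close> and sums concern \<open>borel\<close>,
    which on the naturals has the same sets as the counting space.\<close>
  have nat_borel: "measurable M (borel :: nat measure) = measurable M (count_space UNIV)"
    by (intro measurable_cong_sets refl) (simp add: sets_borel_eq_count_space)
  have e: "?e j \<in> borel_measurable M" if "j \<in> {1..k}" for j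
    using nth_sorted_list_of_k_subset[OF I that] unfolding nat_borel by (intro X) auto
  have [measurable]: "(\<lambda>\<omega>. Max ((\<lambda>j. ?e j \<omega>) ` {1..k})) \<in> measurable M (count_space UNIV)"
    unfolding nat_borel[symmetric] by (intro borel_measurable_Max e) auto
  have [measurable]: "(\<lambda>\<omega>. \<Sum>j\<in>{1..k}. ?e j \<omega>) \<in> measurable M (count_space UNIV)"
    unfolding nat_borel[symmetric] by (intro borel_measurable_sum e)
  show "(\<lambda>\<omega>. real (nth_prime (Suc m)) ^
      ((\<Sum>j\<in>{1..k}. ?e j \<omega>) - Max ((\<lambda>j. ?e j \<omega>) ` {1..k}))) \<in> borel_measurable M"
    by measurable
qed

text \<open>The products over \<open>k\<close>-subsets are some of the terms in the expansion of the
  product of \<open>1 + l i\<close>, so the bound is uniform in \<open>F\<close> and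
  \<open>k\<close>.\<close>

lemma sum_k_subsets_le_exp:
  fixes l :: "nat \<Rightarrow> real"
  assumes l: "\<And>n. l (Suc n) \<ge> 0" "\<And>n. (\<Sum>i\<in>{1..n}. l i) \<le> 1"
    and F: "finite F" "F \<subseteq> k_subsets k"
  shows "(\<Sum>I\<in>F. \<Prod>i\<in>I. l i) \<le> exp 1"
proof -
  have l0: "l i \<ge> 0" if "i \<ge> 1" for i
    using l(1)[of "i - 1"] that by simp
  have "finite (\<Union>F)" using F by (auto simp: k_subsets_def)
  then obtain n where n: "\<Union>F \<subseteq> {..n}" by (auto simp: finite_nat_iff_bounded_le)
  have "F \<subseteq> Pow {1..n}" using F n by (fastforce simp: k_subsets_def)
  then have "(\<Sum>I\<in>F. \<Prod>i\<in>I. l i) \<le> exp (\<Sum>i\<in>{1..n}. l i)"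
    by (intro sum_prod_le_exp) (auto intro: l0)
  also have "\<dots> \<le> exp 1" using l(2) by simp
  finally show ?thesis .
qed

text \<open>The geometric mean of \<open>k\<close> numbers with sum at most 1 is at most
  \<open>1 / k\<close>. This is the origin of the range \<open>y2 - y1 \<le> k ^ k\<close>.\<close>

lemma prod_le_inverse_power_card:
  fixes l :: "nat \<Rightarrow> real"
  assumes l: "\<And>n. l (Suc n) \<ge> 0" "\<And>n. (\<Sum>i\<in>{1..n}. l i) \<le> 1"
    and k: "k \<ge> 1" and I: "I \<in> k_subsets k"
  shows "(\<Prod>i\<in>I. l i) \<le> 1 / real k ^ k"
proof -
  have I': "finite I" "card I = k" "I \<subseteq> {1..}" using I by (auto simp: k_subsets_def)
  have l0: "l i \<ge> 0" if "i \<ge> 1" for i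
    using l(1)[of "i - 1"] that by simp
  have l1: "l i \<ge> 0" if "i \<in> I" for i using l0 I' that by auto
  obtain n where n: "I \<subseteq> {..n}" using I'(1) by (auto simp: finite_nat_iff_bounded_le)
  then have "(\<Sum>i\<in>I. l i) \<le> (\<Sum>i\<in>{1..n}. l i)"
    using I' by (intro sum_mono2 l0) auto
  also note l(2)
  finally have s: "(\<Sum>i\<in>I. l i) \<le> 1" .
  have P0: "(\<Prod>i\<in>I. l i) \<ge> 0" using l1 by (intro prod_nonneg) auto
  have "(\<Prod>i\<in>I. l i) powr (1 / real k) \<le> (\<Sum>i\<in>I. l i / real k)"
    using arith_geom_mean[of I l] I' k l1 by fastforce
  also have "\<dots> \<le> 1 / real k"
    using s by (simp add: sum_divide_distrib[symmetric] divide_right_mono)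
  finally have "((\<Prod>i\<in>I. l i) powr (1 / real k)) ^ k \<le> (1 / real k) ^ k"
    by (intro power_mono) auto
  also have "((\<Prod>i\<in>I. l i) powr (1 / real k)) ^ k = (\<Prod>i\<in>I. l i)"
    using P0 k by (cases "(\<Prod>i\<in>I. l i) = 0") (auto simp: powr_power)
  finally show ?thesis by (simp add: power_divide)
qed

lemma countable_k_subsets: "countable (k_subsets k)"
  by (rule countable_subset[OF _ countable_Collect_finite]) (auto simp: k_subsets_def)

lemma infinite_k_subsets:
  assumes "k \<ge> 1"
  shows "infinite (k_subsets k)"
proof -
  have "inj (\<lambda>n. {Suc n..n + k})"
    using assms by (auto simp: inj_on_def Icc_eq_Icc)
  moreover have "range (\<lambda>n. {Suc n..n + k}) \<subseteq> k_subsets k"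
    by (auto simp: k_subsets_def)
  ultimately show ?thesis
    using infinite_super range_inj_infinite by blast
qed

section \<open>Labelled hypergraphs as sets of \<open>k\<close>-subsets\<close>

text \<open>Distinct edges and the absence of isolated vertices make the set of edges determine the
  hypergraph. The index sets in the expansion of the product thereby become hypergraphs.\<close>

definition hgraph_of :: "nat set set \<Rightarrow> hgraph" where
  "hgraph_of S = (\<Union>S, mset_set S)"

lemma bij_betw_hgraph_of:
  assumes k: "k \<ge> 1"
  shows "bij_betw hgraph_of {S \<in> Fpow (k_subsets k). card S = m} (hyp_B k m)"
proof (rule bij_betwI')
  fix S S' assume "S \<in> {S \<in> Fpow (k_subsets k). card S = m}" "S' \<in> {S \<in> Fpow (k_subsets k). card S = m}"
  then show "hgraph_of S = hgraph_of S' \<longleftrightarrow> S = S'"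
    by (auto simp: hgraph_of_def Fpow_def dest: arg_cong[where f = set_mset])
next
  fix S assume "S \<in> {S \<in> Fpow (k_subsets k). card S = m}"
  then have S: "finite S" "S \<subseteq> k_subsets k" "card S = m" by (auto simp: Fpow_def)
  show "hgraph_of S \<in> hyp_B k m"
    using S k unfolding hyp_B_def labelled_hypergraph_def hgraph_of_def
    by (fastforce simp: k_subsets_def)
next
  fix H assume H: "H \<in> hyp_B k m"
  define S where "S = set_mset (snd H)"
  have E: "snd H = mset_set S"
  proof (rule multiset_eqI)
    fix e show "count (snd H) e = count (mset_set S) e"
      using H by (cases "e \<in># snd H") (auto simp: hyp_B_def S_def count_mset_set' not_in_iff)
  qed
  have "H = hgraph_of S"
  proof (rule prod_eqI)
    show "fst H = fst (hgraph_of S)"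
      using H by (auto simp: hgraph_of_def hyp_B_def labelled_hypergraph_def S_def)
    show "snd H = snd (hgraph_of S)" by (simp add: hgraph_of_def E)
  qed
  moreover have "S \<in> Fpow (k_subsets k)"
    using H by (auto simp: Fpow_def S_def hyp_B_def labelled_hypergraph_def k_subsets_def)
  moreover have "card S = m"
    using H E by (auto simp: hyp_B_def)
  ultimately show "\<exists>S\<in>{S \<in> Fpow (k_subsets k). card S = m}. H = hgraph_of S" by blast
qed

text \<open>Double counting of the incidences between vertices and edges: the degree of
  \<open>i\<close> is the number of edges in which the factor \<open>l i\<close> occurs.\<close>

lemma L_monomial_hgraph_of:
  assumes S: "S \<in> Fpow (k_subsets k)"
  shows "L_monomial l (hgraph_of S) = (\<Prod>I\<in>S. \<Prod>i\<in>I. l i)"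
proof -
  have fS: "finite S" and fI: "\<And>I. I \<in> S \<Longrightarrow> finite I" using S by (auto simp: Fpow_def k_subsets_def)
  have "(\<Prod>I\<in>S. \<Prod>i\<in>I. l i) = (\<Prod>I\<in>S. \<Prod>i\<in>{i\<in>\<Union>S. i \<in> I}. l i)"
    by (intro prod.cong) auto
  also have "\<dots> = (\<Prod>i\<in>\<Union>S. \<Prod>I\<in>{I\<in>S. i \<in> I}. l i)"
    using fS fI by (intro prod.swap_restrict) auto
  also have "\<dots> = L_monomial l (hgraph_of S)"
    using fS by (simp add: L_monomial_def hgraph_of_def)
  finally show ?thesis ..
qed

section \<open>Canonical representatives of label-preserving isomorphism classes\<close>

definition rank_in :: "nat set \<Rightarrow> nat \<Rightarrow> nat" where
  "rank_in V i = card {j \<in> V. j \<le> i}"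

definition canonical_labelling :: "hgraph \<Rightarrow> hgraph" where
  "canonical_labelling H =
     ({1..card (fst H)}, image_mset ((`) (rank_in (fst H))) (snd H))"

lemma strict_mono_rank_in: "finite V \<Longrightarrow> strict_mono_on V (rank_in V)"
proof (rule strict_mono_onI)
  fix r s assume "finite V" "r \<in> V" "s \<in> V" "r < s"
  then have "{j \<in> V. j \<le> r} \<subseteq> {j \<in> V. j \<le> s}" "s \<in> {j \<in> V. j \<le> s}" "s \<notin> {j \<in> V. j \<le> r}"
    by auto
  then have "{j \<in> V. j \<le> r} \<subset> {j \<in> V. j \<le> s}" by blast
  then show "rank_in V r < rank_in V s"
    unfolding rank_in_def using \<open>finite V\<close> by (intro psubset_card_mono) auto
qed

lemma bij_betw_rank_in:
  assumes "finite V"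
  shows "bij_betw (rank_in V) V {1..card V}"
proof -
  have inj: "inj_on (rank_in V) V"
    using strict_mono_rank_in[OF assms] by (rule strict_mono_on_imp_inj_on)
  have "rank_in V ` V \<subseteq> {1..card V}"
  proof
    fix r assume "r \<in> rank_in V ` V"
    then obtain i where i: "i \<in> V" "r = card {j \<in> V. j \<le> i}" by (auto simp: rank_in_def)
    have "card {j \<in> V. j \<le> i} > 0" using i assms by (subst card_gt_0_iff) auto
    moreover have "card {j \<in> V. j \<le> i} \<le> card V" using assms by (intro card_mono) auto
    ultimately show "r \<in> {1..card V}" using i by simp
  qed
  then have "rank_in V ` V = {1..card V}"
    using inj by (intro card_subset_eq) (simp_all add: card_image)
  with inj show ?thesis by (simp add: bij_betw_def)
qed

text \<open>Such an \<open>f\<close> maps the elements of \<open>V\<close> up to \<open>i\<close>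
  onto \<open>{1..f i}\<close>, so \<open>f i\<close> counts them.\<close>

lemma strict_mono_bij_eq_rank_in:
  assumes f: "bij_betw f V {1..r::nat}" "strict_mono_on V f" and i: "i \<in> V"
  shows "f i = rank_in V i"
proof -
  have "f ` {j \<in> V. j \<le> i} = {1..f i}"
  proof (intro set_eqI iffI)
    fix y assume "y \<in> f ` {j \<in> V. j \<le> i}"
    then obtain j where j: "j \<in> V" "j \<le> i" "y = f j" by auto
    then have "f j \<le> f i" using f(2) i by (metis le_less strict_mono_onD)
    with j f(1) show "y \<in> {1..f i}" by (auto simp: bij_betw_def)
  next
    fix y assume y: "y \<in> {1..f i}"
    moreover have "f i \<in> {1..r}" using bij_betwE[OF f(1)] i by blast
    ultimately have "y \<in> {1..r}" by auto
    then have "y \<in> f ` V" using f(1) by (simp add: bij_betw_def)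
    then obtain j where j: "j \<in> V" "y = f j" by blast
    have "j \<le> i"
      using strict_mono_onD[OF f(2) i j(1)] y j by (cases "j \<le> i") auto
    with j show "y \<in> f ` {j \<in> V. j \<le> i}" by auto
  qed
  then have "card {1..f i} = card {j \<in> V. j \<le> i}"
    using f(1) by (metis (no_types, lifting) bij_betw_def card_image inj_on_subset mem_Collect_eq subsetI)
  then show ?thesis by (simp add: rank_in_def)
qed

lemma finite_vertices_hyp_B:
  assumes "H \<in> hyp_B k m"
  shows "finite (fst H)"
proof -
  have "fst H = \<Union>(set_mset (snd H))"
    using assms by (auto simp: hyp_B_def labelled_hypergraph_def)
  moreover have "finite (\<Union>(set_mset (snd H)))"
    using assms by (auto simp: hyp_B_def)
  ultimately show ?thesis by simp
qed

lemma label_iso_canonical_labelling: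
  assumes "H \<in> hyp_B k m"
  shows "label_iso H (canonical_labelling H)"
  using bij_betw_rank_in[OF finite_vertices_hyp_B[OF assms]]
    strict_mono_rank_in[OF finite_vertices_hyp_B[OF assms]]
  unfolding label_iso_def canonical_labelling_def by auto

text \<open>The labels of \<open>G\<close> form an initial segment, which forces the isomorphism to
  be the rank function. Hence every hypergraph belongs to exactly one class indexed by
  \<open>hyp_A k m\<close>.\<close>

lemma label_iso_imp_eq_canonical_labelling:
  assumes H: "H \<in> hyp_B k m" and G: "G \<in> hyp_A k m" and iso: "label_iso H G"
  shows "G = canonical_labelling H"
proof -
  obtain r where r: "fst G = {1..r}" using G by (auto simp: hyp_A_def)
  obtain f where f: "bij_betw f (fst H) {1..r}" "strict_mono_on (fst H) f"
    "image_mset ((`) f) (snd H) = snd G"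
    using iso r by (auto simp: label_iso_def)
  have "card (fst H) = r" using bij_betw_same_card[OF f(1)] by simp
  moreover have "image_mset ((`) f) (snd H) = image_mset ((`) (rank_in (fst H))) (snd H)"
  proof (intro image_mset_cong image_cong refl)
    fix e i assume "e \<in># snd H" "i \<in> e"
    then have "i \<in> fst H" using H by (auto simp: hyp_B_def labelled_hypergraph_def)
    then show "f i = rank_in (fst H) i" by (rule strict_mono_bij_eq_rank_in[OF f(1,2)])
  qed
  ultimately show ?thesis
    using r f(3) by (auto simp: canonical_labelling_def prod_eq_iff)
qed

text \<open>Injectivity of \<open>f\<close> keeps distinct edges distinct, so relabelling the
  multiset of edges is the same as taking the image of the edge set.\<close>

lemma label_iso_hgraph_of_imp:
  assumes S: "S \<in> Fpow (k_subsets k)" and f: "bij_betw f (\<Union>S) V" and G: "fst G = V"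
    and e: "image_mset ((`) f) (mset_set S) = snd G"
  shows "G = hgraph_of ((`) f ` S)"
proof -
  have "inj_on ((`) f) S"
    using f by (intro inj_on_image) (auto simp: bij_betw_def)
  then show ?thesis
    using assms by (simp add: hgraph_of_def prod_eq_iff image_mset_mset_set bij_betw_def image_Union)
qed

lemma image_image_Fpow_k_subsets:
  assumes S: "S \<in> Fpow (k_subsets k)" and f: "inj_on f (\<Union>S)" "f ` \<Union>S \<subseteq> {1..}"
  shows "(`) f ` S \<in> Fpow (k_subsets k)"
proof -
  have "f ` I \<in> k_subsets k" if "I \<in> S" for I
  proof -
    have "f ` I \<subseteq> {1..}" using f(2) that by blast
    moreover have "inj_on f I" using f(1) that by (auto intro: inj_on_subset)
    ultimately show ?thesis using S that by (auto simp: Fpow_def k_subsets_def card_image)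
  qed
  then show ?thesis using S by (auto simp: Fpow_def)
qed

lemma canonical_labelling_in_hyp_A:
  assumes k: "k \<ge> 1" and H: "H \<in> hyp_B k m"
  shows "canonical_labelling H \<in> hyp_A k m"
proof -
  obtain S where S: "S \<in> Fpow (k_subsets k)" "card S = m" "H = hgraph_of S"
    using bij_betw_hgraph_of[OF k, of m] H by (auto simp: bij_betw_def)
  define f where "f = rank_in (fst H)"
  have bij: "bij_betw f (\<Union>S) {1..card (fst H)}"
    using bij_betw_rank_in[OF finite_vertices_hyp_B[OF H]] by (simp add: f_def S(3) hgraph_of_def)
  have inj: "inj_on f (\<Union>S)" using bij by (simp add: bij_betw_def)
  have "canonical_labelling H = hgraph_of ((`) f ` S)"
    using bij by (intro label_iso_hgraph_of_imp[OF S(1)])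
      (auto simp: canonical_labelling_def f_def S(3) hgraph_of_def)
  moreover have "(`) f ` S \<in> Fpow (k_subsets k)"
    using bij by (intro image_image_Fpow_k_subsets S inj) (auto simp: bij_betw_def)
  moreover have "card ((`) f ` S) = m"
    using inj S(2) by (simp add: card_image inj_on_image)
  ultimately have "canonical_labelling H \<in> hyp_B k m"
    using bij_betw_hgraph_of[OF k, of m] by (auto simp: bij_betw_def)
  then show ?thesis
    by (auto simp: hyp_A_def canonical_labelling_def)
qed

text \<open>The edges cover at most \<open>m * k\<close> vertices, so no label exceeds
  \<open>m * k\<close>.\<close>

lemma finite_hyp_A:
  assumes k: "k \<ge> 1"
  shows "finite (hyp_A k m)"
proof (rule finite_subset)
  show "hyp_A k m \<subseteq> hgraph_of ` Pow (Pow {..m * k})"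
  proof
    fix G assume G: "G \<in> hyp_A k m"
    then have "G \<in> hyp_B k m" by (auto simp: hyp_A_def)
    then obtain S where S: "finite S" "S \<subseteq> k_subsets k" "card S = m" "G = hgraph_of S"
      using bij_betw_hgraph_of[OF k, of m] by (auto simp: bij_betw_def Fpow_def)
    obtain r where r: "\<Union>S = {1..r}" using G S by (auto simp: hyp_A_def hgraph_of_def)
    have "r = card (\<Union>S)" by (simp add: r)
    also have "\<dots> \<le> (\<Sum>I\<in>S. card I)" using card_Union_le_sum_card .
    also have "\<dots> = m * k" using S by (subst sum.cong[OF refl, of S card "\<lambda>_. k"]) (auto simp: k_subsets_def)
    finally have "\<Union>S \<subseteq> {..m * k}" using r by auto
    then show "G \<in> hgraph_of ` Pow (Pow {..m * k})" using S by blast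
  qed
qed simp

lemma sorted_list_of_set_image_strict_mono:
  fixes f :: "nat \<Rightarrow> nat"
  assumes "strict_mono_on A f" "finite A"
  shows "sorted_list_of_set (f ` A) = map f (sorted_list_of_set A)"
proof (rule sorted_distinct_set_unique)
  show "sorted (map f (sorted_list_of_set A))"
    unfolding sorted_map
    by (rule sorted_wrt_mono_rel[OF _ sorted_sorted_list_of_set])
      (use assms in \<open>auto simp: strict_mono_on_def le_less\<close>)
  show "distinct (map f (sorted_list_of_set A))"
    using assms strict_mono_on_imp_inj_on[OF assms(1)] by (simp add: distinct_map)
qed (use assms in auto)

text \<open>\<open>submatrix\<close> orders columns by their labels; a strictly monotone
  \<open>f\<close> commutes with sorting, so the columns appear in the same order on both
  sides.\<close>

lemma gfun_submatrix_image:
  assumes f: "strict_mono_on I f" and I: "I \<in> k_subsets k"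
  shows "gfun k (submatrix x (f ` I)) = gfun k (submatrix (\<lambda>m i. x m (f i)) I)"
proof (rule gfun_cong)
  fix m j assume "j \<in> {1..k}"
  then show "submatrix x (f ` I) (Suc m) j = submatrix (\<lambda>m i. x m (f i)) I (Suc m) j"
    using I unfolding submatrix_def
    by (subst sorted_list_of_set_image_strict_mono[OF f]) (auto simp: k_subsets_def)
qed

section \<open>Expectations of infinite products\<close>

lemma sum_prod_Fpow_le_exp:
  fixes b :: "'i \<Rightarrow> real"
  assumes b: "\<And>i. i \<in> K \<Longrightarrow> b i \<ge> 0"
    and B: "\<And>F. finite F \<Longrightarrow> F \<subseteq> K \<Longrightarrow> (\<Sum>i\<in>F. b i) \<le> B"
    and \<F>: "finite \<F>" "\<F> \<subseteq> Fpow K"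
  shows "(\<Sum>S\<in>\<F>. \<Prod>i\<in>S. b i) \<le> exp B"
proof -
  have U: "finite (\<Union>\<F>)" "\<Union>\<F> \<subseteq> K" using \<F> by (auto simp: Fpow_def)
  have "(\<Sum>S\<in>\<F>. \<Prod>i\<in>S. b i) \<le> exp (\<Sum>i\<in>\<Union>\<F>. b i)"
    using U by (intro sum_prod_le_exp b) auto
  also have "\<dots> \<le> exp B" using B[OF U] by simp
  finally show ?thesis .
qed

lemma infinite_Fpow:
  assumes "infinite K"
  shows "infinite (Fpow K)"
proof
  assume "finite (Fpow K)"
  moreover have "(\<lambda>i. {i}) ` K \<subseteq> Fpow K" by (auto simp: Fpow_def)
  ultimately have "finite ((\<lambda>i. {i}) ` K)" by (rule rev_finite_subset)
  then show False using assms by (auto dest: finite_imageD simp: inj_on_def)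
qed

section \<open>Preimage families for independence arguments\<close>

lemma Int_stable_vimage: "Int_stable {X -` A \<inter> \<Omega> | A. A \<in> sets N}"
proof (rule Int_stableI)
  fix a b assume "a \<in> {X -` A \<inter> \<Omega> | A. A \<in> sets N}" "b \<in> {X -` A \<inter> \<Omega> | A. A \<in> sets N}"
  then obtain A A' where "A \<in> sets N" "a = X -` A \<inter> \<Omega>" "A' \<in> sets N" "b = X -` A' \<inter> \<Omega>"
    by auto
  then show "a \<inter> b \<in> {X -` A \<inter> \<Omega> | A. A \<in> sets N}"
    by (intro CollectI exI[of _ "A \<inter> A'"]) auto
qed

lemma vimage_comp_sets_subset:
  assumes X: "X \<in> measurable M S" and f: "f \<in> measurable S N"
  shows "{(f \<circ> X) -` A \<inter> space M | A. A \<in> sets N} \<subseteq> {X -` A \<inter> space M | A. A \<in> sets S}"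
proof
  fix B assume "B \<in> {(f \<circ> X) -` A \<inter> space M | A. A \<in> sets N}"
  then obtain A where A: "A \<in> sets N" "B = (f \<circ> X) -` A \<inter> space M" by blast
  have "B = X -` (f -` A \<inter> space S) \<inter> space M"
    using A(2) measurable_space[OF X] by auto
  then show "B \<in> {X -` A \<inter> space M | A. A \<in> sets S}"
    using measurable_sets[OF f A(1)] by blast
qed

context prob_space
begin

text \<open>The family is kept abstract because it is instantiated by \<open>edge_mass\<close>, by
  \<open>rate\<close> and by multiples of \<open>rate\<close>. The bound \<open>B\<close> controls
  all finite sums, hence all sums of products through \<open>sum_prod_Fpow_le_exp\<close>.\<close>

context
  fixes K :: "'i set" and b :: "'i \<Rightarrow> 'a \<Rightarrow> real" and B :: real
  assumes b_measurable: "\<And>i. i \<in> K \<Longrightarrow> b i \<in> borel_measurable M"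
    and b_bound: "AE \<omega> in M. (\<forall>i\<in>K. b i \<omega> \<ge> 0) \<and>
      (\<forall>F. finite F \<longrightarrow> F \<subseteq> K \<longrightarrow> (\<Sum>i\<in>F. b i \<omega>) \<le> B)"
begin

lemma AE_prod_Fpow_le_exp:
  "AE \<omega> in M. \<forall>S\<in>Fpow K. (\<Prod>i\<in>S. b i \<omega>) \<ge> 0 \<and> (\<Prod>i\<in>S. b i \<omega>) \<le> exp B"
  using b_bound
proof eventually_elim
  case (elim \<omega>)
  show ?case
  proof (intro ballI conjI)
    fix S assume S: "S \<in> Fpow K"
    show "(\<Prod>i\<in>S. b i \<omega>) \<ge> 0" using S elim by (intro prod_nonneg) (auto simp: Fpow_def)
    show "(\<Prod>i\<in>S. b i \<omega>) \<le> exp B"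
      using sum_prod_Fpow_le_exp[of K "\<lambda>i. b i \<omega>" B "{S}"] elim S by simp
  qed
qed

lemma prod_Fpow_measurable:
  "S \<in> Fpow K \<Longrightarrow> (\<lambda>\<omega>. \<Prod>i\<in>S. b i \<omega>) \<in> borel_measurable M"
  by (intro borel_measurable_prod b_measurable) (auto simp: Fpow_def)

lemma integrable_prod_Fpow:
  assumes S: "S \<in> Fpow K"
  shows "integrable M (\<lambda>\<omega>. \<Prod>i\<in>S. b i \<omega>)"
proof (rule integrable_const_bound[where B = "exp B"])
  show "AE \<omega> in M. norm (\<Prod>i\<in>S. b i \<omega>) \<le> exp B"
    using AE_prod_Fpow_le_exp by eventually_elim (use S in \<open>auto simp: abs_of_nonneg\<close>)
qed (rule prod_Fpow_measurable[OF S])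

lemma expectation_prod_Fpow_nonneg:
  assumes S: "S \<in> Fpow K"
  shows "expectation (\<lambda>\<omega>. \<Prod>i\<in>S. b i \<omega>) \<ge> 0"
  by (rule integral_nonneg_AE) (use AE_prod_Fpow_le_exp S in \<open>auto elim!: eventually_mono\<close>)

lemma sum_expectation_prod_Fpow_le:
  assumes \<F>: "finite \<F>" "\<F> \<subseteq> Fpow K"
  shows "(\<Sum>S\<in>\<F>. expectation (\<lambda>\<omega>. \<Prod>i\<in>S. b i \<omega>)) \<le> exp B"
proof -
  have "(\<Sum>S\<in>\<F>. expectation (\<lambda>\<omega>. \<Prod>i\<in>S. b i \<omega>)) = expectation (\<lambda>\<omega>. \<Sum>S\<in>\<F>. \<Prod>i\<in>S. b i \<omega>)"
    using \<F> by (intro Bochner_Integration.integral_sum[symmetric] integrable_prod_Fpow) auto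
  also have "\<dots> \<le> expectation (\<lambda>\<omega>. exp B)"
  proof (rule integral_mono_AE)
    show "AE \<omega> in M. (\<Sum>S\<in>\<F>. \<Prod>i\<in>S. b i \<omega>) \<le> exp B"
      using b_bound
    proof eventually_elim
      case (elim \<omega>)
      then show ?case by (intro sum_prod_Fpow_le_exp[OF _ _ \<F>]) auto
    qed
  qed (use \<F> in \<open>auto intro!: Bochner_Integration.integrable_sum integrable_prod_Fpow\<close>)
  finally show ?thesis by (simp add: prob_space)
qed

lemma summable_expectation_prod_Fpow:
  "(\<lambda>S. expectation (\<lambda>\<omega>. \<Prod>i\<in>S. b i \<omega>)) summable_on Fpow K"
  using sum_expectation_prod_Fpow_le expectation_prod_Fpow_nonneg
  by (intro nonneg_bdd_above_summable_on bdd_aboveI[of _ "exp B"]) auto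

text \<open>The product expands almost surely into a sum over \<open>Fpow K\<close>. Enumerating
  \<open>Fpow K\<close> turns it into a series whose expected absolute values are summable, so
  expectation and series may be exchanged.\<close>

lemma has_sum_expectation_infprod:
  assumes K: "countable K" "infinite K"
  shows "((\<lambda>S. (-1) ^ card S * expectation (\<lambda>\<omega>. \<Prod>i\<in>S. b i \<omega>)) has_sum
    expectation (\<lambda>\<omega>. infprod (\<lambda>i. 1 - b i \<omega>) K)) (Fpow K)"
proof -
  define s where "s = from_nat_into (Fpow K)"
  have bij: "bij_betw s UNIV (Fpow K)"
    unfolding s_def using K by (intro bij_betw_from_nat_into countable_Fpow infinite_Fpow)
  have s: "s n \<in> Fpow K" for n using bij by (auto simp: bij_betw_def)
  have s_fin: "finite (s ` {..<n})" "s ` {..<n} \<subseteq> Fpow K" for n using s by auto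
  have inj: "inj_on s A" for A using bij by (auto simp: bij_betw_def intro: inj_on_subset)
  define f where "f n \<omega> = (-1) ^ card (s n) * (\<Prod>i\<in>s n. b i \<omega>)" for n \<omega>
  have f_prod: "f n \<omega> = (\<Prod>i\<in>s n. - b i \<omega>)" for n \<omega>
    by (simp add: f_def prod_uminus)
  have f_norm: "AE \<omega> in M. \<forall>n. norm (f n \<omega>) = (\<Prod>i\<in>s n. b i \<omega>)"
    using AE_prod_Fpow_le_exp by eventually_elim (use s in \<open>auto simp: f_def abs_mult\<close>)
  have f_int: "integrable M (f n)" for n
    unfolding f_def by (intro integrable_mult_right integrable_prod_Fpow s)
  have norm_int: "expectation (\<lambda>\<omega>. norm (f n \<omega>)) = expectation (\<lambda>\<omega>. \<Prod>i\<in>s n. b i \<omega>)" for n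
  proof (rule integral_cong_AE)
    show "AE \<omega> in M. norm (f n \<omega>) = (\<Prod>i\<in>s n. b i \<omega>)"
      using f_norm by eventually_elim auto
  qed (use f_int[of n] prod_Fpow_measurable[OF s[of n]] in auto)
  have summable_norm: "summable (\<lambda>n. expectation (\<lambda>\<omega>. norm (f n \<omega>)))"
    unfolding norm_int
  proof (rule summableI_nonneg_bounded)
    fix n
    show "(\<Sum>j<n. expectation (\<lambda>\<omega>. \<Prod>i\<in>s j. b i \<omega>)) \<le> exp B"
      using sum_expectation_prod_Fpow_le[OF s_fin, of n] by (simp add: sum.reindex[OF inj])
  qed (rule expectation_prod_Fpow_nonneg[OF s])
  have pointwise: "AE \<omega> in M. summable (\<lambda>n. norm (f n \<omega>)) \<and>
      infprod (\<lambda>i. 1 - b i \<omega>) K = (\<Sum>n. f n \<omega>)"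
    using b_bound f_norm
  proof eventually_elim
    case (elim \<omega>)
    have norm: "norm (f n \<omega>) = (\<Prod>i\<in>s n. b i \<omega>)" for n using elim by blast
    have sm: "summable (\<lambda>n. norm (f n \<omega>))"
    proof (rule summableI_nonneg_bounded)
      fix n
      have "(\<Sum>S\<in>s ` {..<n}. \<Prod>i\<in>S. b i \<omega>) \<le> exp B"
        by (rule sum_prod_Fpow_le_exp[OF _ _ s_fin]) (use elim in auto)
      then show "(\<Sum>j<n. norm (f j \<omega>)) \<le> exp B"
        by (simp only: norm sum.reindex[OF inj] o_def)
    qed simp
    \<comment> \<open>Absolute convergence makes the series an unordered sum, which can be moved to
      \<open>Fpow K\<close> along the enumeration.\<close>
    have "((\<lambda>n. f n \<omega>) has_sum (\<Sum>n. f n \<omega>)) UNIV"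
      by (rule norm_summable_imp_has_sum[OF sm summable_sums[OF summable_norm_cancel[OF sm]]])
    then have "((\<lambda>S. \<Prod>i\<in>S. - b i \<omega>) has_sum (\<Sum>n. f n \<omega>)) (Fpow K)"
      unfolding f_prod
      using has_sum_reindex_bij_betw[OF bij, of "\<lambda>S. \<Prod>i\<in>S. - b i \<omega>"] by simp
    then have "((\<lambda>F. \<Prod>i\<in>F. 1 + - b i \<omega>) \<longlongrightarrow> (\<Sum>n. f n \<omega>)) (finite_subsets_at_top K)"
      by (rule tendsto_prod_one_plus)
    then have "infprod (\<lambda>i. 1 - b i \<omega>) K = (\<Sum>n. f n \<omega>)"
      unfolding infprod_def by (intro tendsto_Lim) auto
    with sm show ?case by blast
  qed
  have ae_sm: "AE \<omega> in M. summable (\<lambda>n. norm (f n \<omega>))"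
    using pointwise by eventually_elim auto
  have "expectation (\<lambda>\<omega>. infprod (\<lambda>i. 1 - b i \<omega>) K) = expectation (\<lambda>\<omega>. \<Sum>n. f n \<omega>)"
  proof (rule integral_cong_AE)
    show "(\<lambda>\<omega>. infprod (\<lambda>i. 1 - b i \<omega>) K) \<in> borel_measurable M"
      using K b_measurable by (intro borel_measurable_infprod) auto
    show "(\<lambda>\<omega>. \<Sum>n. f n \<omega>) \<in> borel_measurable M"
      using f_int by (intro borel_measurable_suminf) auto
    show "AE \<omega> in M. infprod (\<lambda>i. 1 - b i \<omega>) K = (\<Sum>n. f n \<omega>)"
      using pointwise by eventually_elim auto
  qed
  then have "(\<lambda>n. expectation (f n)) sums expectation (\<lambda>\<omega>. infprod (\<lambda>i. 1 - b i \<omega>) K)"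
    using sums_integral[OF f_int ae_sm summable_norm] by simp
  \<comment> \<open>The return from a series to an unordered sum again requires absolute
    convergence.\<close>
  moreover have "summable (\<lambda>n. norm (expectation (f n)))"
    by (rule summable_comparison_test'[OF summable_norm, of 0]) (simp add: integral_norm_bound)
  ultimately have "((\<lambda>n. expectation (f n)) has_sum
      expectation (\<lambda>\<omega>. infprod (\<lambda>i. 1 - b i \<omega>) K)) UNIV"
    by (intro norm_summable_imp_has_sum)
  then show ?thesis
    unfolding f_def
    using has_sum_reindex_bij_betw[OF bij, of "\<lambda>S. (-1) ^ card S * expectation (\<lambda>\<omega>. \<Prod>i\<in>S. b i \<omega>)"]
    by simp
qed

end

text \<open>Functions of \<open>X\<close> and \<open>Y\<close> generate smaller families of events,
  which inherit independence. Stability under intersections extends it to the generated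
  sigma-algebras occurring in \<open>indep_var_eq\<close>.\<close>

lemma indep_var_compose_vimage:
  assumes X: "X \<in> measurable M S" and Y: "Y \<in> measurable M T"
    and indep: "indep_set {X -` A \<inter> space M | A. A \<in> sets S} {Y -` A \<inter> space M | A. A \<in> sets T}"
    and f: "f \<in> measurable S N" and g: "g \<in> measurable T N'"
  shows "indep_var N (f \<circ> X) N' (g \<circ> Y)"
proof -
  have "{(f \<circ> X) -` A \<inter> space M | A. A \<in> sets N} \<subseteq> {X -` A \<inter> space M | A. A \<in> sets S}"
    using X f by (rule vimage_comp_sets_subset)
  moreover have "{(g \<circ> Y) -` A \<inter> space M | A. A \<in> sets N'} \<subseteq> {Y -` A \<inter> space M | A. A \<in> sets T}"
    using Y g by (rule vimage_comp_sets_subset)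
  ultimately have "indep_set {(f \<circ> X) -` A \<inter> space M | A. A \<in> sets N}
      {(g \<circ> Y) -` A \<inter> space M | A. A \<in> sets N'}"
    using indep unfolding indep_set_def
    by (elim indep_sets_mono_sets) (auto split: bool.split)
  then show ?thesis
    unfolding indep_var_eq using measurable_comp[OF X f] measurable_comp[OF Y g]
    by (intro conjI indep_set_sigma_sets Int_stable_vimage)
qed

end

section \<open>The power series of the gap probability\<close>

text \<open>The probabilistic data of the limiting expectation. The gap probabilities themselves
  enter only at the end, as limits.\<close>

locale gap_model = prob_space M for M :: "'a measure" +
  fixes \<theta> :: real and k :: nat
    and L :: "nat \<Rightarrow> 'a \<Rightarrow> real" and X :: "nat \<Rightarrow> nat \<Rightarrow> 'a \<Rightarrow> nat"
  assumes \<theta>: "\<theta> > 0" and k: "k \<ge> 1"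
    and L_measurable: "\<And>i. i \<ge> 1 \<Longrightarrow> L i \<in> borel_measurable M"
    and L_law: "distr M (PiM {1..} (\<lambda>_. borel)) (\<lambda>\<omega>. \<lambda>i\<in>{1..}. L i \<omega>) = poisson_dirichlet \<theta>"
    and X_indep: "indep_vars (\<lambda>_. count_space UNIV) (\<lambda>(m, i). X m i) ({1..} \<times> {1..})"
    and X_law: "\<And>m i a. m \<ge> 1 \<Longrightarrow> i \<ge> 1 \<Longrightarrow>
                  prob {\<omega> \<in> space M. X m i \<omega> = a}
                    = (1 - 1 / real (nth_prime m)) * (1 / real (nth_prime m) ^ a)"
    and LX_indep: "indep_set
                     {(\<lambda>\<omega>. \<lambda>i\<in>{1..}. L i \<omega>) -` S \<inter> space M | S. S \<in> sets (PiM {1..} (\<lambda>_. borel))}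
                     {(\<lambda>\<omega>. \<lambda>(m, i)\<in>{1..} \<times> {1..}. X m i \<omega>) -` S \<inter> space M | S.
                        S \<in> sets (PiM ({1..} \<times> {1..}) (\<lambda>_. count_space UNIV))}"
begin

section \<open>Almost sure properties of \<open>L\<close> and \<open>X\<close>\<close>

lemma X_measurable: "m \<ge> 1 \<Longrightarrow> i \<ge> 1 \<Longrightarrow> X m i \<in> measurable M (count_space UNIV)"
  using X_indep unfolding indep_vars_def by fastforce

lemma L_vec_measurable: "(\<lambda>\<omega>. \<lambda>i\<in>{1..}. L i \<omega>) \<in> measurable M (PiM {1..} (\<lambda>_. borel))"
  by (intro measurable_restrict L_measurable) auto

lemma X_vec_measurable: "(\<lambda>\<omega>. \<lambda>(m, i)\<in>{1..} \<times> {1..}. X m i \<omega>) \<in>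
    measurable M (PiM ({1..} \<times> {1..}) (\<lambda>_. count_space UNIV))"
proof -
  have "(\<lambda>\<omega>. \<lambda>p\<in>{1..} \<times> {1..}. X (fst p) (snd p) \<omega>) \<in>
    measurable M (PiM ({1..} \<times> {1..}) (\<lambda>_. count_space UNIV))"
    by (intro measurable_restrict X_measurable) auto
  then show ?thesis by (simp add: case_prod_unfold)
qed

lemma AE_L: "AE \<omega> in M. \<forall>n. L (Suc n) \<omega> \<ge> 0 \<and> (\<Sum>i\<in>{1..n}. L i \<omega>) \<le> 1"
proof -
  have "AE \<omega> in M. \<forall>n. (\<lambda>i\<in>{1..}. L i \<omega>) (Suc n) \<ge> 0 \<and>
      (\<Sum>i\<in>{1..n}. (\<lambda>i\<in>{1..}. L i \<omega>) i) \<le> 1"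
    using AE_poisson_dirichlet[OF \<theta>] unfolding L_law[symmetric]
    by (rule AE_distrD[OF L_vec_measurable])
  then show ?thesis by eventually_elim auto
qed

lemma prob_X_nonzero:
  assumes "i \<ge> 1"
  shows "prob {\<omega> \<in> space M. X (Suc m) i \<omega> \<noteq> 0} = 1 / real (nth_prime (Suc m))"
proof -
  have [measurable]: "X (Suc m) i \<in> measurable M (count_space UNIV)"
    using assms by (intro X_measurable) auto
  have "prob {\<omega> \<in> space M. X (Suc m) i \<omega> \<noteq> 0} = 1 - prob {\<omega> \<in> space M. X (Suc m) i \<omega> = 0}"
    by (intro prob_neg) measurable
  then show ?thesis using X_law[of "Suc m" i 0] assms by simp
qed

text \<open>Two independent entries in the row of the prime \<open>p\<close> are both nonzero with
  probability \<open>1 / p ^ 2\<close>, which is summable over the primes. Borel-Cantelli applies to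
  each of the countably many pairs of columns.\<close>

lemma AE_sparse_columns: "AE \<omega> in M. sparse_columns (\<lambda>m i. X m i \<omega>)"
  unfolding sparse_columns_def AE_all_countable
proof (intro allI)
  fix i j :: nat
  show "AE \<omega> in M. i \<noteq> j \<longrightarrow>
    (\<forall>\<^sub>F m in sequentially. X (Suc m) (Suc i) \<omega> = 0 \<or> X (Suc m) (Suc j) \<omega> = 0)"
  proof (cases "i = j")
    case False
    define A where "A m = {\<omega>\<in>space M. X (Suc m) (Suc i) \<omega> \<noteq> 0 \<and> X (Suc m) (Suc j) \<omega> \<noteq> 0}" for m
    have [measurable]: "X (Suc m) (Suc n) \<in> measurable M (count_space UNIV)" for m n
      by (intro X_measurable) auto
    have A: "A m \<in> events" for m unfolding A_def by measurable
    have prob_A: "prob (A m) = 1 / real (nth_prime (Suc m)) ^ 2" for m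
    proof -
      let ?J = "{(Suc m, Suc i), (Suc m, Suc j)}"
      let ?Y = "\<lambda>p. (\<lambda>(m, i). X m i) p -` (- {0}) \<inter> space M"
      have "prob (\<Inter>p\<in>?J. ?Y p) = (\<Prod>p\<in>?J. prob (?Y p))"
        by (rule indep_varsD[OF X_indep]) auto
      moreover have "(\<Inter>p\<in>?J. ?Y p) = A m" by (auto simp: A_def)
      moreover have "?Y (Suc m, Suc n) = {\<omega> \<in> space M. X (Suc m) (Suc n) \<omega> \<noteq> 0}" for n by auto
      ultimately show ?thesis using False prob_X_nonzero by (simp add: power2_eq_square)
    qed
    have "summable (\<lambda>m. prob (A m))"
    \<comment> \<open>The comparison starts at 1 because \<open>inverse (0 ^ 2)\<close> is 0 and
      would not dominate the first probability.\<close>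
    proof (rule summable_comparison_test'[of _ 1])
      show "summable (\<lambda>m. inverse (real m ^ 2))" by (rule inverse_power_summable) simp
      fix m :: nat assume m: "m \<ge> 1"
      then show "norm (prob (A m)) \<le> inverse (real m ^ 2)"
        using nth_prime_Suc(2)[of m] unfolding prob_A
        by (auto simp: inverse_eq_divide intro!: divide_left_mono power_mono mult_pos_pos)
    qed
    then have "AE \<omega> in M. \<forall>\<^sub>F m in sequentially. \<omega> \<in> space M - A m"
      using A by (intro borel_cantelli_AE1) (auto simp: emeasure_eq_measure)
    then show ?thesis
      by eventually_elim (auto simp: A_def elim!: eventually_mono)
  qed simp
qed

section \<open>Weights and masses of edges, and the factorisation of expectations\<close>

definition edge_weight :: "nat set \<Rightarrow> 'a \<Rightarrow> real" where
  "edge_weight I \<omega> = 1 / gfun k (submatrix (\<lambda>m i. X m i \<omega>) I)"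

definition edge_mass :: "nat set \<Rightarrow> 'a \<Rightarrow> real" where
  "edge_mass I \<omega> = (\<Prod>i\<in>I. L i \<omega>)"

lemma psi_hgraph_of:
  assumes "S \<in> Fpow (k_subsets k)"
  shows "psi M X k (hgraph_of S) = expectation (\<lambda>\<omega>. \<Prod>I\<in>S. edge_weight I \<omega>)"
  unfolding psi_def hgraph_of_def edge_weight_def by (simp add: prod_unfold_prod_mset)

lemma EL_hgraph_of:
  assumes "S \<in> Fpow (k_subsets k)"
  shows "EL M L (hgraph_of S) = expectation (\<lambda>\<omega>. \<Prod>I\<in>S. edge_mass I \<omega>)"
  unfolding EL_def edge_mass_def L_monomial_hgraph_of[OF assms] ..

lemma edge_mass_measurable: "I \<in> k_subsets k \<Longrightarrow> edge_mass I \<in> borel_measurable M"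
  unfolding edge_mass_def by (intro borel_measurable_prod L_measurable) (auto simp: k_subsets_def)

lemma edge_weight_measurable: "I \<in> k_subsets k \<Longrightarrow> edge_weight I \<in> borel_measurable M"
  unfolding edge_weight_def
  by (intro borel_measurable_divide borel_measurable_const borel_measurable_gfun_submatrix X_measurable)
    (auto simp: k_subsets_def)

lemma AE_edge_weight: "AE \<omega> in M. \<forall>I\<in>k_subsets k. 0 < edge_weight I \<omega> \<and> edge_weight I \<omega> \<le> 1"
  using AE_sparse_columns
proof eventually_elim
  case (elim \<omega>)
  show ?case
  proof
    fix I assume "I \<in> k_subsets k"
    from gfun_submatrix_ge_1[OF elim this] show "0 < edge_weight I \<omega> \<and> edge_weight I \<omega> \<le> 1"
      by (simp add: edge_weight_def)
  qed
qed

lemma AE_edge_mass: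
  "AE \<omega> in M. (\<forall>I\<in>k_subsets k. 0 \<le> edge_mass I \<omega> \<and> edge_mass I \<omega> \<le> 1 / real k ^ k) \<and>
     (\<forall>F. finite F \<longrightarrow> F \<subseteq> k_subsets k \<longrightarrow> (\<Sum>I\<in>F. edge_mass I \<omega>) \<le> exp 1)"
  using AE_L
proof eventually_elim
  case (elim \<omega>)
  then have l: "\<And>n. L (Suc n) \<omega> \<ge> 0" "\<And>n. (\<Sum>i\<in>{1..n}. L i \<omega>) \<le> 1" by blast+
  have "0 \<le> edge_mass I \<omega>" if "I \<in> k_subsets k" for I
    unfolding edge_mass_def
  proof (rule prod_nonneg)
    fix i assume "i \<in> I"
    then have "i \<ge> 1" using that by (auto simp: k_subsets_def)
    then show "0 \<le> L i \<omega>" using l(1)[of "i - 1"] by simp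
  qed
  then show ?case
    using prod_le_inverse_power_card[of "\<lambda>i. L i \<omega>", OF l k] sum_k_subsets_le_exp[of "\<lambda>i. L i \<omega>", OF l]
    by (simp add: edge_mass_def)
qed

text \<open>With \<open>x = y2 - y1\<close>, the factor of the limiting product that belongs to
  \<open>I\<close> is \<open>1 - min (x * rate I \<omega>) 1\<close>.\<close>

definition rate :: "nat set \<Rightarrow> 'a \<Rightarrow> real" where
  "rate I \<omega> = edge_mass I \<omega> * edge_weight I \<omega>"

lemma rate_measurable: "I \<in> k_subsets k \<Longrightarrow> rate I \<in> borel_measurable M"
  unfolding rate_def by (intro borel_measurable_times edge_mass_measurable edge_weight_measurable)

lemma AE_rate:
  "AE \<omega> in M. (\<forall>I\<in>k_subsets k. 0 \<le> rate I \<omega> \<and> rate I \<omega> \<le> 1 / real k ^ k) \<and>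
     (\<forall>F. finite F \<longrightarrow> F \<subseteq> k_subsets k \<longrightarrow> (\<Sum>I\<in>F. rate I \<omega>) \<le> exp 1)"
  using AE_edge_mass AE_edge_weight
proof eventually_elim
  case (elim \<omega>)
  have le: "0 \<le> rate I \<omega> \<and> rate I \<omega> \<le> edge_mass I \<omega>" if "I \<in> k_subsets k" for I
  proof -
    have "0 \<le> edge_mass I \<omega>" "0 < edge_weight I \<omega>" "edge_weight I \<omega> \<le> 1"
      using elim that by blast+
    then show ?thesis by (simp add: rate_def mult_left_le)
  qed
  show ?case
  proof (intro conjI ballI allI impI)
    fix I assume I: "I \<in> k_subsets k"
    show "0 \<le> rate I \<omega>" using le[OF I] by blast
    have "edge_mass I \<omega> \<le> 1 / real k ^ k" using elim I by blast
    then show "rate I \<omega> \<le> 1 / real k ^ k" using le[OF I] by linarith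
  next
    fix F assume F: "finite F" "F \<subseteq> k_subsets k"
    have "(\<Sum>I\<in>F. rate I \<omega>) \<le> (\<Sum>I\<in>F. edge_mass I \<omega>)"
      using le F by (intro sum_mono) auto
    also have "\<dots> \<le> exp 1" using elim F by blast
    finally show "(\<Sum>I\<in>F. rate I \<omega>) \<le> exp 1" .
  qed
qed

text \<open>The masses depend only on \<open>L\<close> and the weights only on \<open>X\<close>.
  Both products are bounded almost surely, so independence splits the expectation.\<close>

lemma expectation_prod_rate:
  assumes S: "S \<in> Fpow (k_subsets k)"
  shows "expectation (\<lambda>\<omega>. \<Prod>I\<in>S. rate I \<omega>) = psi M X k (hgraph_of S) * EL M L (hgraph_of S)"
proof -
  have I1: "I \<subseteq> {1..}" if "I \<in> S" for I using S that by (auto simp: Fpow_def k_subsets_def)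
  have SK: "I \<in> k_subsets k" if "I \<in> S" for I using S that by (auto simp: Fpow_def)
  let ?PL = "PiM {1::nat..} (\<lambda>_. borel :: real measure)"
  let ?PX = "PiM ({1::nat..} \<times> {1::nat..}) (\<lambda>_. count_space (UNIV :: nat set))"
  define fL where "fL l = (\<Prod>I\<in>S. \<Prod>i\<in>I. l i)" for l :: "nat \<Rightarrow> real"
  define fX where "fX x = (\<Prod>I\<in>S. 1 / gfun k (submatrix (\<lambda>m i. x (m, i)) I))"
    for x :: "nat \<times> nat \<Rightarrow> nat"
  have fL: "fL \<in> borel_measurable ?PL"
    unfolding fL_def using I1
    by (intro borel_measurable_prod measurable_component_singleton) auto
  have fX: "fX \<in> borel_measurable ?PX"
    unfolding fX_def using I1
    by (intro borel_measurable_prod borel_measurable_divide borel_measurable_const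
        borel_measurable_gfun_submatrix SK measurable_component_singleton) auto
  have "indep_var borel (fL \<circ> (\<lambda>\<omega>. \<lambda>i\<in>{1..}. L i \<omega>)) borel
      (fX \<circ> (\<lambda>\<omega>. \<lambda>(m, i)\<in>{1..} \<times> {1..}. X m i \<omega>))"
    by (rule indep_var_compose_vimage[OF L_vec_measurable X_vec_measurable LX_indep fL fX])
  also have "fL \<circ> (\<lambda>\<omega>. \<lambda>i\<in>{1..}. L i \<omega>) = (\<lambda>\<omega>. \<Prod>I\<in>S. edge_mass I \<omega>)"
    unfolding fL_def edge_mass_def o_def using I1
    by (intro ext prod.cong refl) (auto simp: subset_iff)
  also have "fX \<circ> (\<lambda>\<omega>. \<lambda>(m, i)\<in>{1..} \<times> {1..}. X m i \<omega>) = (\<lambda>\<omega>. \<Prod>I\<in>S. edge_weight I \<omega>)"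
    unfolding fX_def edge_weight_def o_def
  \<comment> \<open>Restricting the array to positive indices changes nothing: \<open>gfun\<close>
    reads rows of the form \<open>Suc m\<close> and the labels in \<open>I\<close> are
    positive.\<close>
  proof (intro ext prod.cong refl arg_cong[where f = "\<lambda>x. 1 / x"] gfun_cong)
    fix \<omega> I m j assume I: "I \<in> S" and j: "j \<in> {1..k}"
    have "sorted_list_of_set I ! (j - 1) \<in> {1..}"
      using nth_sorted_list_of_k_subset[OF SK[OF I] j] I1[OF I] by blast
    then show "submatrix (\<lambda>m i. (\<lambda>(m, i)\<in>{1..} \<times> {1..}. X m i \<omega>) (m, i)) I (Suc m) j =
        submatrix (\<lambda>m i. X m i \<omega>) I (Suc m) j"
      by (simp add: submatrix_def)
  qed
  finally have ind: "indep_var borel (\<lambda>\<omega>. \<Prod>I\<in>S. edge_mass I \<omega>) borel (\<lambda>\<omega>. \<Prod>I\<in>S. edge_weight I \<omega>)" .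
  have int_mass: "integrable M (\<lambda>\<omega>. \<Prod>I\<in>S. edge_mass I \<omega>)"
    by (rule integrable_prod_Fpow[OF edge_mass_measurable _ S, where B = "exp 1"])
      (use AE_edge_mass in \<open>auto elim!: eventually_mono\<close>)
  have int_weight: "integrable M (\<lambda>\<omega>. \<Prod>I\<in>S. edge_weight I \<omega>)"
  proof (rule integrable_const_bound[where B = 1])
    show "AE \<omega> in M. norm (\<Prod>I\<in>S. edge_weight I \<omega>) \<le> 1"
      using AE_edge_weight
    proof eventually_elim
      case (elim \<omega>)
      then have "0 < edge_weight I \<omega> \<and> edge_weight I \<omega> \<le> 1" if "I \<in> S" for I
        using SK[OF that] by blast
      then have "0 \<le> \<bar>edge_weight I \<omega>\<bar> \<and> \<bar>edge_weight I \<omega>\<bar> \<le> 1" if "I \<in> S" for I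
        using that by force
      then show ?case by (simp add: abs_prod prod_le_1)
    qed
  qed (intro borel_measurable_prod edge_weight_measurable SK)
  show ?thesis
    using indep_var_lebesgue_integral[OF ind int_mass int_weight]
    by (simp add: rate_def prod.distrib psi_hgraph_of[OF S] EL_hgraph_of[OF S] mult.commute)
qed

text \<open>The entries are independent and their laws depend only on the row, so every injective
  selection of columns has the same joint law. Column 1 serves as reference, which keeps
  \<open>f\<close> out of the right-hand side.\<close>

lemma distr_columns:
  fixes f :: "nat \<Rightarrow> nat"
  assumes V: "inj_on f V" "f ` V \<subseteq> {1..}"
  shows "distr M (PiM ({1..} \<times> V) (\<lambda>_. count_space UNIV)) (\<lambda>\<omega>. \<lambda>p\<in>{1..} \<times> V. X (fst p) (f (snd p)) \<omega>) =
    PiM ({1..} \<times> V) (\<lambda>p. distr M (count_space UNIV) (X (fst p) 1))"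
proof -
  let ?I = "{1::nat..} \<times> {1::nat..}" and ?J = "{1::nat..} \<times> V"
  let ?cs = "\<lambda>_::nat \<times> nat. count_space (UNIV :: nat set)"
  define D where "D p = distr M (count_space UNIV) (X (fst p) (snd p))" for p
  \<comment> \<open>\<open>h\<close> sends a position among the selected columns to its position in
    the full array; injectivity makes the reindexed marginals a product measure again.\<close>
  define h where "h p = (fst p, f (snd p))" for p :: "nat \<times> nat"
  have D_prob: "prob_space (D p)" if "p \<in> ?I" for p
    using that unfolding D_def by (intro prob_space_distr X_measurable) auto
  have X_vec: "(\<lambda>\<omega>. \<lambda>p\<in>?I. X (fst p) (snd p) \<omega>) \<in> measurable M (PiM ?I ?cs)"
    by (intro measurable_restrict X_measurable) auto
  have "distr M (PiM ?I ?cs) (\<lambda>\<omega>. \<lambda>p\<in>?I. X (fst p) (snd p) \<omega>) = PiM ?I D"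
    using indep_vars_iff_distr_eq_PiM'[of ?I "\<lambda>p. X (fst p) (snd p)" ?cs] X_indep X_measurable
    by (auto simp: D_def[abs_def] case_prod_unfold)
  moreover have h: "inj_on h ?J" "h \<in> ?J \<rightarrow> ?I"
    using V by (auto simp: inj_on_def h_def)
  ultimately have law: "distr (distr M (PiM ?I ?cs) (\<lambda>\<omega>. \<lambda>p\<in>?I. X (fst p) (snd p) \<omega>))
      (PiM ?J (\<lambda>p. D (h p))) (\<lambda>x. \<lambda>p\<in>?J. x (h p)) = PiM ?J (\<lambda>p. D (h p))"
    using distr_PiM_reindex[of ?I D h ?J] D_prob by simp
  have sets_eq: "sets (PiM ?J (\<lambda>p. D (h p))) = sets (PiM ?J ?cs)"
    by (intro sets_PiM_cong) (auto simp: D_def)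
  have h_meas: "(\<lambda>x. \<lambda>p\<in>?J. x (h p)) \<in> measurable (PiM ?I ?cs) (PiM ?J ?cs)"
    using h by (intro measurable_restrict measurable_component_singleton) auto
  have "distr (distr M (PiM ?I ?cs) (\<lambda>\<omega>. \<lambda>p\<in>?I. X (fst p) (snd p) \<omega>))
        (PiM ?J (\<lambda>p. D (h p))) (\<lambda>x. \<lambda>p\<in>?J. x (h p)) =
      distr (distr M (PiM ?I ?cs) (\<lambda>\<omega>. \<lambda>p\<in>?I. X (fst p) (snd p) \<omega>)) (PiM ?J ?cs) (\<lambda>x. \<lambda>p\<in>?J. x (h p))"
    by (intro distr_cong sets_eq refl)
  note trans[OF law[symmetric] this]
  also have "\<dots> = distr M (PiM ?J ?cs) ((\<lambda>x. \<lambda>p\<in>?J. x (h p)) \<circ> (\<lambda>\<omega>. \<lambda>p\<in>?I. X (fst p) (snd p) \<omega>))"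
    by (rule distr_distr[OF h_meas X_vec])
  also have "(\<lambda>x. \<lambda>p\<in>?J. x (h p)) \<circ> (\<lambda>\<omega>. \<lambda>p\<in>?I. X (fst p) (snd p) \<omega>) =
      (\<lambda>\<omega>. \<lambda>p\<in>?J. X (fst p) (f (snd p)) \<omega>)"
    using V(2) by (intro ext) (auto simp: h_def restrict_def image_subset_iff)
  finally have joint: "PiM ?J (\<lambda>p. D (h p)) =
      distr M (PiM ?J ?cs) (\<lambda>\<omega>. \<lambda>p\<in>?J. X (fst p) (f (snd p)) \<omega>)" .
  have "PiM ?J (\<lambda>p. D (h p)) = PiM ?J (\<lambda>p. distr M (count_space UNIV) (X (fst p) 1))"
  proof (intro PiM_cong refl)
    fix p assume "p \<in> ?J"
    then have p: "fst p \<ge> 1" "f (snd p) \<ge> 1" using V by auto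
    show "D (h p) = distr M (count_space UNIV) (X (fst p) 1)"
      unfolding D_def
    proof (rule measure_eqI_countable[where A = UNIV])
      fix a
      have "prob {\<omega> \<in> space M. X (fst p) (f (snd p)) \<omega> = a} = prob {\<omega> \<in> space M. X (fst p) 1 \<omega> = a}"
        using p by (simp add: X_law)
      moreover have "X (fst p) i -` {a} \<inter> space M = {\<omega> \<in> space M. X (fst p) i \<omega> = a}" for i
        by auto
      ultimately show "emeasure (distr M (count_space UNIV) (X (fst (h p)) (snd (h p)))) {a} =
          emeasure (distr M (count_space UNIV) (X (fst p) 1)) {a}"
        using p by (simp add: emeasure_distr X_measurable h_def emeasure_eq_measure)
    qed auto
  qed
  then show ?thesis unfolding joint .
qed

text \<open>Both sides are the integral of one functional of the array with columns in the union of
  \<open>S\<close>, against a product measure in which \<open>f\<close> does not occur.\<close>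

lemma psi_relabel:
  assumes S: "S \<in> Fpow (k_subsets k)"
    and f: "strict_mono_on (\<Union>S) f" "f ` \<Union>S \<subseteq> {1..}"
  shows "psi M X k (hgraph_of ((`) f ` S)) = psi M X k (hgraph_of S)"
proof -
  let ?J = "{1::nat..} \<times> \<Union>S"
  define \<Phi> where "\<Phi> x = (\<Prod>I\<in>S. 1 / gfun k (submatrix (\<lambda>m i. x (m, i)) I))"
    for x :: "nat \<times> nat \<Rightarrow> nat"
  have SK: "I \<in> k_subsets k" if "I \<in> S" for I using S that by (auto simp: Fpow_def)
  have pos: "\<Union>S \<subseteq> {1..}" using SK by (auto simp: k_subsets_def)
  have \<Phi>: "\<Phi> \<in> borel_measurable (PiM ?J (\<lambda>_. count_space UNIV))"
    unfolding \<Phi>_def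
    by (intro borel_measurable_prod borel_measurable_divide borel_measurable_const
        borel_measurable_gfun_submatrix SK measurable_component_singleton) auto
  \<comment> \<open>Applied below with \<open>f\<close> and with the identity as
    \<open>g\<close>.\<close>
  have key: "expectation (\<lambda>\<omega>. \<Prod>I\<in>S. 1 / gfun k (submatrix (\<lambda>m i. X m (g i) \<omega>) I)) =
      (\<integral>x. \<Phi> x \<partial>PiM ?J (\<lambda>p. distr M (count_space UNIV) (X (fst p) 1)))"
    if g: "inj_on g (\<Union>S)" "g ` \<Union>S \<subseteq> {1..}" for g
  proof -
    have g1: "g i \<ge> 1" if "i \<in> \<Union>S" for i
      using subsetD[OF g(2) imageI[OF that]] by simp
    have vec: "(\<lambda>\<omega>. \<lambda>p\<in>?J. X (fst p) (g (snd p)) \<omega>) \<in> measurable M (PiM ?J (\<lambda>_. count_space UNIV))"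
      by (intro measurable_restrict X_measurable g1) auto
    have "(\<Prod>I\<in>S. 1 / gfun k (submatrix (\<lambda>m i. X m (g i) \<omega>) I)) =
        \<Phi> (\<lambda>p\<in>?J. X (fst p) (g (snd p)) \<omega>)" for \<omega>
      unfolding \<Phi>_def
    proof (intro prod.cong refl arg_cong[where f = "\<lambda>x. 1 / x"] gfun_cong)
      fix I m j assume I: "I \<in> S" and j: "j \<in> {1..k}"
      have "sorted_list_of_set I ! (j - 1) \<in> \<Union>S"
        using nth_sorted_list_of_k_subset[OF SK[OF I] j] I by blast
      then show "submatrix (\<lambda>m i. X m (g i) \<omega>) I (Suc m) j =
          submatrix (\<lambda>m i. (\<lambda>p\<in>?J. X (fst p) (g (snd p)) \<omega>) (m, i)) I (Suc m) j"
        by (simp add: submatrix_def)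
    qed
    then show ?thesis
      unfolding distr_columns[OF g, symmetric] integral_distr[OF vec \<Phi>] by (simp only:)
  qed
  have inj: "inj_on f (\<Union>S)" using f(1) by (rule strict_mono_on_imp_inj_on)
  have "psi M X k (hgraph_of ((`) f ` S)) =
      expectation (\<lambda>\<omega>. \<Prod>I\<in>S. 1 / gfun k (submatrix (\<lambda>m i. X m i \<omega>) (f ` I)))"
    using image_image_Fpow_k_subsets[OF S inj f(2)] inj_on_image[OF inj]
    by (simp add: psi_hgraph_of edge_weight_def prod.reindex)
  also have "\<dots> = expectation (\<lambda>\<omega>. \<Prod>I\<in>S. 1 / gfun k (submatrix (\<lambda>m i. X m (f i) \<omega>) I))"
    by (intro Bochner_Integration.integral_cong prod.cong refl arg_cong[where f = "\<lambda>x. 1 / x"]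
        gfun_submatrix_image SK monotone_on_subset[OF f(1)]) auto
  also have "\<dots> = expectation (\<lambda>\<omega>. \<Prod>I\<in>S. 1 / gfun k (submatrix (\<lambda>m i. X m i \<omega>) I))"
    using key[OF inj f(2)] key[of "\<lambda>i. i"] pos by simp
  also have "\<dots> = psi M X k (hgraph_of S)"
    by (simp add: psi_hgraph_of[OF S] edge_weight_def)
  finally show ?thesis .
qed

lemma psi_label_iso:
  assumes H: "H \<in> hyp_B k m" and G: "G \<in> hyp_A k m" and iso: "label_iso H G"
  shows "psi M X k H = psi M X k G"
proof -
  obtain S where S: "S \<in> Fpow (k_subsets k)" "H = hgraph_of S"
    using bij_betw_hgraph_of[OF k, of m] H by (auto simp: bij_betw_def)
  obtain f where f: "bij_betw f (fst H) (fst G)" "strict_mono_on (fst H) f"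
    "image_mset ((`) f) (snd H) = snd G"
    using iso by (auto simp: label_iso_def)
  have "G = hgraph_of ((`) f ` S)"
    using f S by (intro label_iso_hgraph_of_imp[OF S(1)]) (auto simp: hgraph_of_def)
  moreover have "f ` \<Union>S \<subseteq> {1..}"
    using f(1) G S(2) by (auto simp: hyp_A_def bij_betw_def hgraph_of_def)
  ultimately show ?thesis
    using psi_relabel[OF S(1), of f] f(2) S(2) by (simp add: hgraph_of_def)
qed

section \<open>The coefficients and the power series\<close>

definition gap_coeff :: "nat \<Rightarrow> real" where
  "gap_coeff m = (\<Sum>\<^sub>\<infinity>H\<in>hyp_B k m. psi M X k H * EL M L H)"

lemma summable_on_hyp_B_iff:
  "f summable_on hyp_B k m \<longleftrightarrow> (\<lambda>S. f (hgraph_of S)) summable_on {S \<in> Fpow (k_subsets k). card S = m}"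
  by (rule summable_on_reindex_bij_betw[OF bij_betw_hgraph_of[OF k], symmetric])

lemma summable_psi_EL:
  "(\<lambda>S. psi M X k (hgraph_of S) * EL M L (hgraph_of S)) summable_on Fpow (k_subsets k)"
proof -
  have "(\<lambda>S. expectation (\<lambda>\<omega>. \<Prod>I\<in>S. rate I \<omega>)) summable_on Fpow (k_subsets k)"
    by (rule summable_expectation_prod_Fpow[OF rate_measurable, where B = "exp 1"])
      (use AE_rate in \<open>auto elim!: eventually_mono\<close>)
  also have "?this \<longleftrightarrow> ?thesis"
    by (intro summable_on_cong expectation_prod_rate)
  finally show ?thesis .
qed

text \<open>Summability over all finite sets of \<open>k\<close>-subsets passes to those of size
  \<open>m\<close>, so the default value 0 of \<open>infsum\<close> for families without a sum does
  not occur in \<open>gap_coeff\<close>.\<close>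

lemma has_sum_gap_coeff:
  "((\<lambda>H. psi M X k H * EL M L H) has_sum gap_coeff m) (hyp_B k m)"
proof -
  have "(\<lambda>S. psi M X k (hgraph_of S) * EL M L (hgraph_of S)) summable_on
      {S \<in> Fpow (k_subsets k). card S = m}"
    by (rule summable_on_subset_banach[OF summable_psi_EL]) auto
  then have "(\<lambda>H. psi M X k H * EL M L H) summable_on hyp_B k m"
    unfolding summable_on_hyp_B_iff .
  then show ?thesis unfolding gap_coeff_def by (rule has_sum_infsum)
qed

text \<open>The inner sums over an isomorphism class carry no factor \<open>psi\<close>, so their
  summability comes from the masses alone.\<close>

lemma summable_EL: "EL M L summable_on hyp_B k m"
proof -
  have "(\<lambda>S. expectation (\<lambda>\<omega>. \<Prod>I\<in>S. edge_mass I \<omega>)) summable_on Fpow (k_subsets k)"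
    by (rule summable_expectation_prod_Fpow[OF edge_mass_measurable, where B = "exp 1"])
      (use AE_edge_mass in \<open>auto elim!: eventually_mono\<close>)
  also have "?this \<longleftrightarrow> (\<lambda>S. EL M L (hgraph_of S)) summable_on Fpow (k_subsets k)"
    by (intro summable_on_cong EL_hgraph_of[symmetric])
  finally show ?thesis
    unfolding summable_on_hyp_B_iff by (rule summable_on_subset_banach) auto
qed

text \<open>Each \<open>H\<close> lies in the class of its canonical labelling and in no other, and
  \<open>psi\<close> is constant on classes. The sum over \<open>hyp_B k m\<close> can thus be taken
  class by class with \<open>psi\<close> pulled out.\<close>

lemma gap_coeff_eq_sum_hyp_A:
  "gap_coeff m = (\<Sum>G\<in>hyp_A k m. psi M X k G *
     (\<Sum>\<^sub>\<infinity>H\<in>{H \<in> hyp_B k m. label_iso H G}. EL M L H))"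
proof -
  define C where "C G = {H \<in> hyp_B k m. label_iso H G}" for G
  have bij: "bij_betw snd (Sigma (hyp_A k m) C) (hyp_B k m)"
  proof (rule bij_betwI[where g = "\<lambda>H. (canonical_labelling H, H)"])
    show "snd \<in> Sigma (hyp_A k m) C \<rightarrow> hyp_B k m" by (auto simp: C_def)
    show "(\<lambda>H. (canonical_labelling H, H)) \<in> hyp_B k m \<rightarrow> Sigma (hyp_A k m) C"
      using canonical_labelling_in_hyp_A[OF k] label_iso_canonical_labelling by (auto simp: C_def)
    fix p assume "p \<in> Sigma (hyp_A k m) C"
    then show "(canonical_labelling (snd p), snd p) = p"
      using label_iso_imp_eq_canonical_labelling by (auto simp: C_def)
  qed simp
  have "((\<lambda>p. psi M X k (snd p) * EL M L (snd p)) has_sum gap_coeff m) (Sigma (hyp_A k m) C)"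
    using has_sum_gap_coeff[of m]
      has_sum_reindex_bij_betw[OF bij, of "\<lambda>H. psi M X k H * EL M L H"] by simp
  then have "((\<lambda>G. psi M X k G * (\<Sum>\<^sub>\<infinity>H\<in>C G. EL M L H)) has_sum gap_coeff m) (hyp_A k m)"
  proof (rule has_sum_SigmaD)
    fix G assume G: "G \<in> hyp_A k m"
    have "EL M L summable_on C G"
      by (rule summable_on_subset_banach[OF summable_EL]) (auto simp: C_def)
    then have "((\<lambda>H. psi M X k G * EL M L H) has_sum psi M X k G * (\<Sum>\<^sub>\<infinity>H\<in>C G. EL M L H)) (C G)"
      by (intro has_sum_cmult_right has_sum_infsum)
    also have "?this \<longleftrightarrow> ((\<lambda>H. psi M X k (snd (G, H)) * EL M L (snd (G, H))) has_sum
        psi M X k G * (\<Sum>\<^sub>\<infinity>H\<in>C G. EL M L H)) (C G)"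
      using psi_label_iso[OF _ G] by (intro has_sum_cong) (auto simp: C_def)
    finally show "((\<lambda>H. psi M X k (snd (G, H)) * EL M L (snd (G, H))) has_sum
        psi M X k G * (\<Sum>\<^sub>\<infinity>H\<in>C G. EL M L H)) (C G)" .
  qed
  moreover have "((\<lambda>G. psi M X k G * (\<Sum>\<^sub>\<infinity>H\<in>C G. EL M L H)) has_sum
      (\<Sum>G\<in>hyp_A k m. psi M X k G * (\<Sum>\<^sub>\<infinity>H\<in>C G. EL M L H))) (hyp_A k m)"
    by (rule has_sum_finite[OF finite_hyp_A[OF k]])
  ultimately show ?thesis
    unfolding C_def by (rule has_sum_unique)
qed

lemma gap_expectation_has_sum:
  assumes y: "y1 < y2" "y2 - y1 \<le> real k ^ k"
  shows "((\<lambda>S. (y1 - y2) ^ card S * (psi M X k (hgraph_of S) * EL M L (hgraph_of S))) has_sum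
    gap_expectation M L X k y1 y2) (Fpow (k_subsets k))"
proof -
  let ?K = "k_subsets k"
  define x where "x = y2 - y1"
  have x: "0 < x" "x \<le> real k ^ k" using y by (auto simp: x_def)
  have K: "countable ?K" "infinite ?K" using countable_k_subsets infinite_k_subsets[OF k] by auto
  have meas: "(\<lambda>\<omega>. x * rate I \<omega>) \<in> borel_measurable M" if "I \<in> ?K" for I
    using rate_measurable[OF that] by simp
  have "AE \<omega> in M. (\<forall>I\<in>?K. x * rate I \<omega> \<ge> 0) \<and>
      (\<forall>F. finite F \<longrightarrow> F \<subseteq> ?K \<longrightarrow> (\<Sum>I\<in>F. x * rate I \<omega>) \<le> x * exp 1)"
    using AE_rate
  proof eventually_elim
    case (elim \<omega>)
    then show ?case using x by (simp add: sum_distrib_left[symmetric])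
  qed
  then have "((\<lambda>S. (-1) ^ card S * expectation (\<lambda>\<omega>. \<Prod>I\<in>S. x * rate I \<omega>)) has_sum
      expectation (\<lambda>\<omega>. infprod (\<lambda>I. 1 - x * rate I \<omega>) ?K)) (Fpow ?K)"
    by (intro has_sum_expectation_infprod meas K)
  also have "expectation (\<lambda>\<omega>. infprod (\<lambda>I. 1 - x * rate I \<omega>) ?K) =
      expectation (\<lambda>\<omega>. infprod (\<lambda>I. 1 - min (x * rate I \<omega>) 1) ?K)"
  proof (rule integral_cong_AE)
    show "AE \<omega> in M. infprod (\<lambda>I. 1 - x * rate I \<omega>) ?K = infprod (\<lambda>I. 1 - min (x * rate I \<omega>) 1) ?K"
      using AE_rate
    proof eventually_elim
      case (elim \<omega>)
      show ?case
      proof (rule infprod_cong)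
        fix I assume "I \<in> ?K"
        then have r: "0 \<le> rate I \<omega>" "rate I \<omega> \<le> 1 / real k ^ k" using elim by blast+
        \<comment> \<open>The right-hand side is 1, so the minimum equals its first
          argument.\<close>
        have "x * rate I \<omega> \<le> real k ^ k * (1 / real k ^ k)"
          using x r by (intro mult_mono) auto
        then show "1 - x * rate I \<omega> = 1 - min (x * rate I \<omega>) 1" using k by simp
      qed
    qed
  qed (intro borel_measurable_infprod K borel_measurable_diff borel_measurable_min
      borel_measurable_const meas; assumption)+
  also have "\<dots> = gap_expectation M L X k y1 y2"
    by (simp add: gap_expectation_def rate_def edge_mass_def edge_weight_def x_def)
  also have "((\<lambda>S. (-1) ^ card S * expectation (\<lambda>\<omega>. \<Prod>I\<in>S. x * rate I \<omega>)) has_sum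
        gap_expectation M L X k y1 y2) (Fpow ?K) \<longleftrightarrow> ?thesis"
  proof (rule has_sum_cong)
    fix S assume S: "S \<in> Fpow ?K"
    have "(y1 - y2) ^ card S = (-1) ^ card S * x ^ card S"
      by (simp add: x_def power_mult_distrib[symmetric])
    then show "(-1) ^ card S * expectation (\<lambda>\<omega>. \<Prod>I\<in>S. x * rate I \<omega>) =
        (y1 - y2) ^ card S * (psi M X k (hgraph_of S) * EL M L (hgraph_of S))"
      using expectation_prod_rate[OF S] by (simp add: prod.distrib)
  qed
  finally show ?thesis .
qed

text \<open>The unordered sum over finite sets of edges is grouped by the number of edges.\<close>

lemma gap_expectation_sums:
  assumes y: "y1 < y2" "y2 - y1 \<le> real k ^ k"
  shows "(\<lambda>m. gap_coeff m * (y1 - y2) ^ m) sums gap_expectation M L X k y1 y2"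
proof -
  let ?N = "\<lambda>m. {S \<in> Fpow (k_subsets k). card S = m}"
  let ?e = "\<lambda>S. psi M X k (hgraph_of S) * EL M L (hgraph_of S)"
  have bij: "bij_betw snd (Sigma UNIV ?N) (Fpow (k_subsets k))"
    by (rule bij_betwI[where g = "\<lambda>S. (card S, S)"]) auto
  have "((\<lambda>p. (y1 - y2) ^ card (snd p) * ?e (snd p)) has_sum gap_expectation M L X k y1 y2) (Sigma UNIV ?N)"
    using gap_expectation_has_sum[OF y]
      has_sum_reindex_bij_betw[OF bij, of "\<lambda>S. (y1 - y2) ^ card S * ?e S"] by simp
  then have "((\<lambda>m. gap_coeff m * (y1 - y2) ^ m) has_sum gap_expectation M L X k y1 y2) UNIV"
  proof (rule has_sum_SigmaD)
    fix m
    have "(?e has_sum gap_coeff m) (?N m)"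
      using has_sum_gap_coeff[of m]
        has_sum_reindex_bij_betw[OF bij_betw_hgraph_of[OF k], of "\<lambda>H. psi M X k H * EL M L H"] by simp
    then have "((\<lambda>S. (y1 - y2) ^ m * ?e S) has_sum (y1 - y2) ^ m * gap_coeff m) (?N m)"
      by (rule has_sum_cmult_right)
    also have "?this \<longleftrightarrow> ((\<lambda>S. (y1 - y2) ^ card (snd (m, S)) * ?e (snd (m, S))) has_sum
        gap_coeff m * (y1 - y2) ^ m) (?N m)"
      unfolding mult.commute[of "gap_coeff m"] by (intro has_sum_cong) auto
    finally show "((\<lambda>S. (y1 - y2) ^ card (snd (m, S)) * ?e (snd (m, S))) has_sum
        gap_coeff m * (y1 - y2) ^ m) (?N m)" .
  qed
  then show ?thesis by (rule has_sum_imp_sums)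
qed

end

text \<open>\<open>gap_limit\<close> is the limit theorem that identifies the gap probability.
  Existence together with a claim about every representing sequence makes the coefficients well
  defined without naming them in advance.\<close>

theorem lemma10p1:
  fixes \<theta> \<alpha> :: real and k :: nat
    and M :: "'a measure"
    and L :: "nat \<Rightarrow> 'a \<Rightarrow> real"
    and X :: "nat \<Rightarrow> nat \<Rightarrow> 'a \<Rightarrow> nat"
  assumes "\<theta> > 0" and "k \<ge> 1"
    and "\<alpha> \<notin> \<rat>" and "irrationality_measure \<alpha> < \<infinity>"
    and "prob_space M"
    and L_measurable: "\<And>i. i \<ge> 1 \<Longrightarrow> L i \<in> borel_measurable M"
    and L_law: "distr M (PiM {1..} (\<lambda>_. borel)) (\<lambda>\<omega>. \<lambda>i\<in>{1..}. L i \<omega>) = poisson_dirichlet \<theta>"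
    and X_indep: "prob_space.indep_vars M (\<lambda>_. count_space UNIV)
                    (\<lambda>(m, i). X m i) ({1..} \<times> {1..})"
    and X_law: "\<And>m i a. m \<ge> 1 \<Longrightarrow> i \<ge> 1 \<Longrightarrow>
                  measure M {\<omega> \<in> space M. X m i \<omega> = a}
                    = (1 - 1 / real (nth_prime m)) * (1 / real (nth_prime m) ^ a)"
    and LX_indep: "prob_space.indep_set M
                     {(\<lambda>\<omega>. \<lambda>i\<in>{1..}. L i \<omega>) -` S \<inter> space M | S. S \<in> sets (PiM {1..} (\<lambda>_. borel))}
                     {(\<lambda>\<omega>. \<lambda>(m, i)\<in>{1..} \<times> {1..}. X m i \<omega>) -` S \<inter> space M | S.
                        S \<in> sets (PiM ({1..} \<times> {1..}) (\<lambda>_. count_space UNIV))}"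
    and gap_limit: "\<And>y1 y2. y1 < y2 \<Longrightarrow>
                      finite_gap_probability \<theta> k \<alpha> y1 y2 \<longlonglongrightarrow> gap_expectation M L X k y1 y2"
  shows "(\<exists>c. power_series_rep k (gap_probability \<theta> k \<alpha>) c) \<and>
    (\<forall>c. power_series_rep k (gap_probability \<theta> k \<alpha>) c \<longrightarrow>
      (\<forall>m. ((\<lambda>H. psi M X k H * EL M L H) has_sum c m) (hyp_B k m) \<and>
           finite (hyp_A k m) \<and>
           (\<forall>G \<in> hyp_A k m. EL M L summable_on {H \<in> hyp_B k m. label_iso H G}) \<and>
           c m = (\<Sum>G \<in> hyp_A k m. psi M X k G *
                   (\<Sum>\<^sub>\<infinity>H \<in> {H \<in> hyp_B k m. label_iso H G}. EL M L H))))"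
proof -
  interpret gap_model M \<theta> k L X
    by (intro gap_model.intro gap_model_axioms.intro) fact+
  let ?P = "gap_probability \<theta> k \<alpha>"
  have P: "?P y1 y2 = gap_expectation M L X k y1 y2" if "y1 < y2" for y1 y2
    unfolding gap_probability_def using gap_limit[OF that] by (rule limI)
  have rep: "power_series_rep k ?P gap_coeff"
    unfolding power_series_rep_def using gap_expectation_sums P by auto
  have unique: "c = gap_coeff" if c: "power_series_rep k ?P c" for c
  \<comment> \<open>The choice \<open>y1 = x\<close> and \<open>y2 = 0\<close> covers exactly the
    arguments in \<open>[-(k ^ k), 0)\<close>.\<close>
  proof (rule powser_coeff_unique_left[where r = "real k ^ k" and P = "\<lambda>x. ?P x 0"])
    show "real k ^ k > 0" using \<open>k \<ge> 1\<close> by simp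
    fix x assume "- (real k ^ k) \<le> x" "x < 0"
    then have x: "x < 0 \<and> 0 - x \<le> real k ^ k" by simp
    show "(\<lambda>n. c n * x ^ n) sums ?P x 0" "(\<lambda>n. gap_coeff n * x ^ n) sums ?P x 0"
      using c[unfolded power_series_rep_def, rule_format, OF x]
        rep[unfolded power_series_rep_def, rule_format, OF x] by simp_all
  qed
  show ?thesis
  proof (intro conjI allI impI ballI)
    show "\<exists>c. power_series_rep k ?P c" using rep by blast
  next
    fix c m assume "power_series_rep k ?P c"
    then have c: "c = gap_coeff" by (rule unique)
    show "((\<lambda>H. psi M X k H * EL M L H) has_sum c m) (hyp_B k m)"
      unfolding c by (rule has_sum_gap_coeff)
    show "finite (hyp_A k m)" by (rule finite_hyp_A[OF \<open>k \<ge> 1\<close>])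
    show "c m = (\<Sum>G\<in>hyp_A k m. psi M X k G *
        (\<Sum>\<^sub>\<infinity>H\<in>{H \<in> hyp_B k m. label_iso H G}. EL M L H))"
      unfolding c by (rule gap_coeff_eq_sum_hyp_A)
    fix G
    show "EL M L summable_on {H \<in> hyp_B k m. label_iso H G}"
      by (rule summable_on_subset_banach[OF summable_EL]) auto
  qed
qed

end
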